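(* Let $(E,\mathcal P)$ be a random locally convex module over $\mathbb R$ with base $(\Omega,\mathcal F,P)$ such that $E$ has the countable concatenation property. If $f:E\to\bar L^0(\mathcal F)$ is a proper, $\mathcal T_c$-lower semicontinuous, $L^0(\mathcal F)$-convex function, then $f^{**}_c=f$. Here $f^*_c:E^*_c\to\bar L^0(\mathcal F)$ is defined by $f^*_c(g)=\bigvee\{g(x)-f(x):x\in E\}$ for all $g\in E^*_c$, and $f^{**}_c:E\to\bar L^0(\mathcal F)$ by $f^{**}_c(x)=\bigvee\{g(x)-f^*_c(g):g\in E^*_c\}$ for all $x\in E$.
   Context: $(\Omega,\mathcal F,P)$ is a probability space. $L^0(\mathcal F)$ is the algebra of (a.s.-equality) equivalence classes of real-valued $\mathcal F$-measurable random variables; $L^0_+(\mathcal F)$ and $L^0_{++}(\mathcal F)$ are its elements that are $\ge0$, respectively $>0$, a.s. on $\Omega$. $\bar L^0(\mathcal F)$ is the complete lattice of equivalence classes of $[-\infty,\infty]$-valued $\mathcal F$-measurable functions with the a.s. order; $\bigvee$ is the supremum there. $\tilde I_A$ is the class of the indicator of $A\in\mathcal F$. Conventions: $0\cdot(\pm\infty)=0$, $+\infty\pm(\pm\infty)=+\infty$. An $L^0$-seminorm on an $L^0(\mathcal F)$-module $E$ is a map $\|\cdot\|:E\to L^0_+(\mathcal F)$ with $\|\xi x\|=|\xi|\|x\|$ and $\|x+y\|\le\|x\|+\|y\|$. A random locally convex module over $\mathbb R$ with base $(\Omega,\mathcal F,P)$ is a pair $(E,\mathcal P)$ with $E$ an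 $L^0(\mathcal F)$-module and $\mathcal P$ a family of $L^0$-seminorms on $E$ such that $\bigvee\{\|x\|:\|\cdot\|\in\mathcal P\}=0$ iff $x=\theta$ (the null element). For finite $\mathcal Q\subset\mathcal P$ put $\|x\|_{\mathcal Q}=\bigvee\{\|x\|:\|\cdot\|\in\mathcal Q\}$. The locally $L^0$-convex topology $\mathcal T_c$ has local base at $\theta$ consisting of $\{x\in E:\|x\|_{\mathcal Q}\le\varepsilon\}$, $\mathcal Q\subset\mathcal P$ finite, $\varepsilon\in L^0_{++}(\mathcal F)$; $L^0(\mathcal F)$ carries the $\mathcal T_c$ induced by $|\cdot|$. $E^*_c$ is the $L^0(\mathcal F)$-module of continuous module homomorphisms from $(E,\mathcal T_c)$ to $(L^0(\mathcal F),\mathcal T_c)$. $E$ has the countable concatenation property if for every sequence $\{x_n\}$ in $E$ and every countable partition $\{A_n\}$ of $\Omega$ into sets of $\mathcal F$ there is $x\in E$ with $\tilde I_{A_n}x=\tilde I_{A_n}x_n$ for all $n$. For $f:E\to\bar L^0(\mathcal F)$: $\mathrm{dom}(f)=\{x\in E:|f(x)|<+\infty\text{ a.s. on }\Omega\}$; $f$ is proper if $\mathrm{dom}(f)\ne\emptyset$ and $f(x)>-\infty$ a.s. on $\Omega$ for all $x\in E$; $f$ is $L^0(\mathcal F)$-convex if $f(\xi x+(1-\xi)y)\le\xi f(x)+(1-\xi)f(y)$ for all $x,y\in E$ and $\xi\in L^0_+(\mathcal F)$ with $0\le\xi\le1$; a proper $f$ is $\mathcal T_c$-lower semicontinuous if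 $\{x\in E:f(x)\le r\}$ is $\mathcal T_c$-closed for every $r\in L^0(\mathcal F)$. *)

theory Defs
  imports "HOL-Probability.Probability" "HOL-Algebra.Module" "HOL-Algebra.Complete_Lattice"
begin

text \<open>
  Elements of \<open>L\<^sup>0\<close> and of its extended version are almost-sure equivalence classes, represented
  as sets of measurable functions.
\<close>

definition ae_class :: "'w measure \<Rightarrow> ('w \<Rightarrow> 'b::topological_space) \<Rightarrow> ('w \<Rightarrow> 'b) set" where
  "ae_class M f = {g \<in> borel_measurable M. AE w in M. g w = f w}"

definition ae_classes :: "'w measure \<Rightarrow> ('w \<Rightarrow> 'b::topological_space) set set" where
  "ae_classes M = ae_class M ` borel_measurable M"

text \<open>The lifts below use some representatives; by \<open>ae_map_class\<close> etc. the choice is immaterial.\<close>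

definition ae_map :: "'w measure \<Rightarrow> ('b \<Rightarrow> 'c::topological_space) \<Rightarrow>
    ('w \<Rightarrow> 'b) set \<Rightarrow> ('w \<Rightarrow> 'c) set" where
  "ae_map M h X = {k \<in> borel_measurable M. \<exists>f\<in>X. AE w in M. k w = h (f w)}"

definition ae_map2 :: "'w measure \<Rightarrow> ('b \<Rightarrow> 'c \<Rightarrow> 'd::topological_space) \<Rightarrow>
    ('w \<Rightarrow> 'b) set \<Rightarrow> ('w \<Rightarrow> 'c) set \<Rightarrow> ('w \<Rightarrow> 'd) set" where
  "ae_map2 M h X Y = {k \<in> borel_measurable M. \<exists>f\<in>X. \<exists>g\<in>Y. AE w in M. k w = h (f w) (g w)}"

definition ae_all :: "'w measure \<Rightarrow> ('b \<Rightarrow> bool) \<Rightarrow> ('w \<Rightarrow> 'b) set \<Rightarrow> bool" where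
  "ae_all M R X \<longleftrightarrow> (\<exists>f\<in>X. AE w in M. R (f w))"

definition ae_le :: "'w measure \<Rightarrow> ('w \<Rightarrow> 'b::ord) set \<Rightarrow> ('w \<Rightarrow> 'b) set \<Rightarrow> bool" where
  "ae_le M X Y \<longleftrightarrow> (\<exists>f\<in>X. \<exists>g\<in>Y. AE w in M. f w \<le> g w)"

lemma ae_class_eq_iff:
  assumes "f \<in> borel_measurable M" "g \<in> borel_measurable M"
  shows "ae_class M f = ae_class M g \<longleftrightarrow> (AE w in M. f w = g w)"
proof
  assume "ae_class M f = ae_class M g"
  moreover have "f \<in> ae_class M f" using assms by (simp add: ae_class_def)
  ultimately show "AE w in M. f w = g w" by (auto simp: ae_class_def)
next
  assume A: "AE w in M. f w = g w"
  have "(AE w in M. k w = f w) \<longleftrightarrow> (AE w in M. k w = g w)" for k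
    using A by (auto elim: eventually_elim2)
  then show "ae_class M f = ae_class M g" by (simp add: ae_class_def)
qed

lemma ae_classesE:
  assumes "X \<in> ae_classes M"
  obtains f where "f \<in> borel_measurable M" "X = ae_class M f"
  using assms by (auto simp: ae_classes_def)

lemma ae_class_in [simp, intro]: "f \<in> borel_measurable M \<Longrightarrow> ae_class M f \<in> ae_classes M"
  by (auto simp: ae_classes_def)

lemma ae_map_class:
  assumes "f \<in> borel_measurable M"
  shows "ae_map M h (ae_class M f) = ae_class M (\<lambda>w. h (f w))"
proof -
  have "(\<exists>f'\<in>ae_class M f. AE w in M. k w = h (f' w)) \<longleftrightarrow> (AE w in M. k w = h (f w))" for k
  proof
    assume "\<exists>f'\<in>ae_class M f. AE w in M. k w = h (f' w)"
    then obtain f' where "AE w in M. f' w = f w" "AE w in M. k w = h (f' w)"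
      by (auto simp: ae_class_def)
    then show "AE w in M. k w = h (f w)" by eventually_elim simp
  next
    assume "AE w in M. k w = h (f w)"
    then show "\<exists>f'\<in>ae_class M f. AE w in M. k w = h (f' w)"
      using assms by (intro bexI[of _ f]) (auto simp: ae_class_def)
  qed
  then show ?thesis by (simp add: ae_map_def ae_class_def[of M "\<lambda>w. h (f w)"])
qed

lemma ae_map2_class:
  assumes "f \<in> borel_measurable M" "g \<in> borel_measurable M"
  shows "ae_map2 M h (ae_class M f) (ae_class M g) = ae_class M (\<lambda>w. h (f w) (g w))"
proof -
  have "(\<exists>f'\<in>ae_class M f. \<exists>g'\<in>ae_class M g. AE w in M. k w = h (f' w) (g' w)) \<longleftrightarrow>
      (AE w in M. k w = h (f w) (g w))" for k
  proof
    assume "\<exists>f'\<in>ae_class M f. \<exists>g'\<in>ae_class M g. AE w in M. k w = h (f' w) (g' w)"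
    then obtain f' g' where "AE w in M. f' w = f w" "AE w in M. g' w = g w"
      "AE w in M. k w = h (f' w) (g' w)"
      by (auto simp: ae_class_def)
    then show "AE w in M. k w = h (f w) (g w)" by eventually_elim simp
  next
    assume "AE w in M. k w = h (f w) (g w)"
    then show "\<exists>f'\<in>ae_class M f. \<exists>g'\<in>ae_class M g. AE w in M. k w = h (f' w) (g' w)"
      using assms by (intro bexI[of _ f] bexI[of _ g]) (auto simp: ae_class_def)
  qed
  then show ?thesis by (simp add: ae_map2_def ae_class_def[of M "\<lambda>w. h (f w) (g w)"])
qed

lemma ae_all_class:
  assumes "f \<in> borel_measurable M"
  shows "ae_all M R (ae_class M f) \<longleftrightarrow> (AE w in M. R (f w))"
proof
  assume "ae_all M R (ae_class M f)"
  then obtain f' where "AE w in M. f' w = f w" "AE w in M. R (f' w)"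
    by (auto simp: ae_all_def ae_class_def)
  then show "AE w in M. R (f w)" by eventually_elim simp
next
  assume "AE w in M. R (f w)"
  then show "ae_all M R (ae_class M f)"
    using assms unfolding ae_all_def by (intro bexI[of _ f]) (auto simp: ae_class_def)
qed

lemma ae_le_class:
  assumes "f \<in> borel_measurable M" "g \<in> borel_measurable M"
  shows "ae_le M (ae_class M f) (ae_class M g) \<longleftrightarrow> (AE w in M. f w \<le> g w)"
proof
  assume "ae_le M (ae_class M f) (ae_class M g)"
  then obtain f' g' where "AE w in M. f' w = f w" "AE w in M. g' w = g w"
    "AE w in M. f' w \<le> g' w"
    by (auto simp: ae_le_def ae_class_def)
  then show "AE w in M. f w \<le> g w" by eventually_elim simp
next
  assume "AE w in M. f w \<le> g w"
  then show "ae_le M (ae_class M f) (ae_class M g)"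
    using assms unfolding ae_le_def
    by (intro bexI[of _ f] bexI[of _ g]) (auto simp: ae_class_def)
qed

text \<open>
  The algebra \<open>L\<^sup>0\<close>. It is given as a module record, so that it serves both as the ring of scalars
  and as a module over itself.
\<close>

definition L0 :: "'w measure \<Rightarrow> (('w \<Rightarrow> real) set, ('w \<Rightarrow> real) set) module" where
  "L0 M = \<lparr>carrier = ae_classes M, mult = ae_map2 M (*), one = ae_class M (\<lambda>_. 1),
     zero = ae_class M (\<lambda>_. 0), add = ae_map2 M (+), smult = ae_map2 M (*)\<rparr>"

lemma cring_L0: "cring (L0 M)"
proof (rule cringI)
  show "abelian_group (L0 M)"
  proof (rule abelian_groupI)
    fix x assume "x \<in> carrier (L0 M)"
    then obtain f where f: "f \<in> borel_measurable M" "x = ae_class M f"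
      by (auto simp: L0_def elim: ae_classesE)
    then show "\<exists>y\<in>carrier (L0 M). y \<oplus>\<^bsub>L0 M\<^esub> x = \<zero>\<^bsub>L0 M\<^esub>"
      by (intro bexI[of _ "ae_class M (\<lambda>w. - f w)"]) (auto simp: L0_def ae_map2_class)
  qed (auto simp: L0_def ae_map2_class add_ac elim!: ae_classesE)
  show "Group.comm_monoid (L0 M)"
    by (rule comm_monoidI) (auto simp: L0_def ae_map2_class mult_ac elim!: ae_classesE)
qed (auto simp: L0_def ae_map2_class algebra_simps elim!: ae_classesE)

lemma module_L0: "Module.module (L0 M) (L0 M)"
proof -
  interpret R: cring "L0 M" by (rule cring_L0)
  show ?thesis
    by (rule moduleI[OF cring_L0 R.abelian_group_axioms])
      (auto simp: L0_def ae_map2_class algebra_simps elim!: ae_classesE)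
qed

definition L0_nonneg :: "'w measure \<Rightarrow> ('w \<Rightarrow> real) set set" where
  "L0_nonneg M = {X \<in> carrier (L0 M). ae_all M (\<lambda>t. t \<ge> 0) X}"

definition L0_pos :: "'w measure \<Rightarrow> ('w \<Rightarrow> real) set set" where
  "L0_pos M = {X \<in> carrier (L0 M). ae_all M (\<lambda>t. t > 0) X}"

definition L0_indicator :: "'w measure \<Rightarrow> 'w set \<Rightarrow> ('w \<Rightarrow> real) set" where
  "L0_indicator M A = ae_class M (indicat_real A)"

definition L0_ext :: "'w measure \<Rightarrow> ('w \<Rightarrow> ereal) set gorder" where
  "L0_ext M = \<lparr>carrier = ae_classes M, eq = (=), le = ae_le M\<rparr>"

lemma L0_ext_sup_exists:
  assumes "prob_space M" and A: "A \<subseteq> carrier (L0_ext M)"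
  shows "\<exists>s. least (L0_ext M) s (Upper (L0_ext M) A)"
proof -
  interpret prob_space M by fact
  define r where "r X = (SOME f. f \<in> borel_measurable M \<and> X = ae_class M f)" for X :: "('a \<Rightarrow> ereal) set"
  have r: "r X \<in> borel_measurable M \<and> X = ae_class M (r X)" if "X \<in> A" for X
  proof -
    have "\<exists>f. f \<in> borel_measurable M \<and> X = ae_class M f"
      using A that by (auto simp: L0_ext_def ae_classes_def)
    then show ?thesis unfolding r_def by (rule someI_ex)
  qed
  define \<phi> :: "ereal \<Rightarrow> real" where
    "\<phi> t = (if t = \<infinity> then 2 else if t = -\<infinity> then -2 else arctan (real_of_ereal t))" for t
  have pi: "pi / 2 < 2" using pi_less_4 by simp
  have arc: "-2 < arctan u" "arctan u < 2" for u
    using arctan_lbound[of u] arctan_ubound[of u] pi by linarith+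
  have \<phi>_mono: "\<phi> s < \<phi> t" if "s < t" for s t
    using that arc by (cases s; cases t) (auto simp: \<phi>_def arctan_less_iff)
  have \<phi>_le: "\<phi> s \<le> \<phi> t" if "s \<le> t" for s t
    using \<phi>_mono[of s t] that by (cases "s = t") (auto simp: order.order_iff_strict)
  have \<phi>_meas [measurable]: "\<phi> \<in> borel_measurable borel"
    unfolding \<phi>_def by measurable
  have \<phi>_bd: "\<bar>\<phi> t\<bar> \<le> 2" for t
    using arc[of "real_of_ereal t"] by (auto simp: \<phi>_def)
  define S where "S C = (\<lambda>w. SUP X\<in>C. r X w)" for C :: "('a \<Rightarrow> ereal) set set"
  define I where "I C = (LINT w|M. \<phi> (S C w))" for C
  have S_meas: "S C \<in> borel_measurable M" if "countable C" "C \<subseteq> A" for C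
    unfolding S_def using that r by (intro borel_measurable_SUP) auto
  have int: "integrable M (\<lambda>w. \<phi> (S C w))" if "countable C" "C \<subseteq> A" for C
    using S_meas[OF that] \<phi>_bd by (intro integrable_const_bound[of _ 2]) auto
  have I_mono: "I C \<le> I D" if "C \<subseteq> D" "countable D" "D \<subseteq> A" for C D
    unfolding I_def
  proof (rule integral_mono)
    show "integrable M (\<lambda>w. \<phi> (S C w))" using that by (intro int) (auto intro: countable_subset)
    show "integrable M (\<lambda>w. \<phi> (S D w))" using that by (intro int)
    show "\<phi> (S C w) \<le> \<phi> (S D w)" for w
      unfolding S_def by (intro \<phi>_le SUP_subset_mono that) auto
  qed
  define K where "K = {C. countable C \<and> C \<subseteq> A}"
  have I_bd: "I C \<le> 2" if "C \<in> K" for C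
  proof -
    have "I C \<le> (LINT w|M. 2)"
      unfolding I_def using that int[of C]
      by (intro integral_mono) (auto simp: K_def intro: order_trans[OF abs_ge_self \<phi>_bd])
    then show ?thesis by (simp add: prob_space)
  qed
  have bdd: "bdd_above (I ` K)" using I_bd by (auto simp: bdd_above_def)
  have ne: "{} \<in> K" by (auto simp: K_def)
  have "\<exists>C\<in>K. (SUP C\<in>K. I C) - 1 / Suc n < I C" for n
    using less_cSUP_iff[OF _ bdd, of "(SUP C\<in>K. I C) - 1 / Suc n"] ne by auto
  then obtain C where C: "\<And>n. C n \<in> K" "\<And>n. (SUP C\<in>K. I C) - 1 / Suc n < I (C n)" by metis
  define D where "D = (\<Union>n. C n)"
  have D: "countable D" "D \<subseteq> A" using C(1) by (auto simp: D_def K_def)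
  have supI: "(SUP C\<in>K. I C) \<le> I D"
  proof (rule field_le_epsilon)
    fix e :: real assume "e > 0"
    then obtain n where n: "1 / Suc n < e" using nat_approx_posE by metis
    have "I (C n) \<le> I D" by (rule I_mono) (use D in \<open>auto simp: D_def\<close>)
    then show "(SUP C\<in>K. I C) \<le> I D + e" using C(2)[of n] n by linarith
  qed
  have upper: "AE w in M. r X w \<le> S D w" if X: "X \<in> A" for X
  proof -
    let ?D = "insert X D"
    have cD: "countable ?D" "?D \<subseteq> A" using D X by auto
    have "I ?D \<le> (SUP C\<in>K. I C)" by (rule cSUP_upper[OF _ bdd]) (use cD in \<open>auto simp: K_def\<close>)
    then have "I ?D \<le> I D" using supI by simp
    moreover have "I D \<le> I ?D" by (rule I_mono) (use cD in auto)
    ultimately have eq: "(LINT w|M. \<phi> (S ?D w) - \<phi> (S D w)) = 0"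
      using int[OF cD] int[OF D] by (simp add: I_def)
    have le: "S D w \<le> S ?D w" for w unfolding S_def by (intro SUP_subset_mono) auto
    have "AE w in M. \<phi> (S ?D w) - \<phi> (S D w) = 0"
      using integral_nonneg_eq_0_iff_AE[of M "\<lambda>w. \<phi> (S ?D w) - \<phi> (S D w)"]
        int[OF cD] int[OF D] eq \<phi>_le[OF le] by auto
    then show ?thesis
    proof eventually_elim
      case (elim w)
      then have "\<not> S D w < S ?D w" using \<phi>_mono[of "S D w" "S ?D w"] by auto
      moreover have "r X w \<le> S ?D w" unfolding S_def by (intro SUP_upper) auto
      ultimately show ?case using le[of w] by auto
    qed
  qed
  have "least (L0_ext M) (ae_class M (S D)) (Upper (L0_ext M) A)"
    unfolding least_def
  proof (intro conjI ballI)
    show "Upper (L0_ext M) A \<subseteq> carrier (L0_ext M)" by (auto simp: Upper_def)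
    have "ae_le M X (ae_class M (S D))" if X: "X \<in> A" for X
      using ae_le_class[of "r X" M "S D"] r[OF X] S_meas[OF D] upper[OF X] by auto
    then show "ae_class M (S D) \<in> Upper (L0_ext M) A"
      using S_meas[OF D] by (auto simp: Upper_def L0_ext_def)
    fix u assume u: "u \<in> Upper (L0_ext M) A"
    then obtain k where k: "k \<in> borel_measurable M" "u = ae_class M k"
      by (auto simp: Upper_def L0_ext_def elim: ae_classesE)
    have "AE w in M. r X w \<le> k w" if "X \<in> A" for X
    proof -
      have "X \<in> carrier (L0_ext M)" using A that by auto
      then have "ae_le M X u" using u that by (auto simp: Upper_def L0_ext_def)
      then show ?thesis using ae_le_class[of "r X" M k] r[OF that] k by auto
    qed
    then have "AE w in M. \<forall>X\<in>D. r X w \<le> k w"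
      using D by (subst AE_ball_countable) auto
    then have "AE w in M. S D w \<le> k w"
      by eventually_elim (auto simp: S_def intro: SUP_least)
    then show "ae_class M (S D) \<sqsubseteq>\<^bsub>L0_ext M\<^esub> u"
      using ae_le_class[of "S D" M k] S_meas[OF D] k by (auto simp: L0_ext_def)
  qed
  then show ?thesis by blast
qed

lemma partial_order_L0_ext: "partial_order (L0_ext M)"
proof
  fix X Y Z :: "('a \<Rightarrow> ereal) set"
  assume X: "X \<in> carrier (L0_ext M)" 
  then show "X .=\<^bsub>L0_ext M\<^esub> X" "X \<sqsubseteq>\<^bsub>L0_ext M\<^esub> X"
    by (auto simp: L0_ext_def ae_le_class elim!: ae_classesE)
  assume Y: "Y \<in> carrier (L0_ext M)" 
  show "X .=\<^bsub>L0_ext M\<^esub> Y" if "X \<sqsubseteq>\<^bsub>L0_ext M\<^esub> Y" "Y \<sqsubseteq>\<^bsub>L0_ext M\<^esub> X"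
  proof -
    obtain f g where fg: "f \<in> borel_measurable M" "X = ae_class M f" 
      "g \<in> borel_measurable M" "Y = ae_class M g"
      using X Y by (auto simp: L0_ext_def elim!: ae_classesE)
    have "AE w in M. f w \<le> g w" "AE w in M. g w \<le> f w"
      using that fg by (auto simp: L0_ext_def ae_le_class)
    then have "AE w in M. f w = g w" by eventually_elim auto
    then show ?thesis using fg by (auto simp: L0_ext_def ae_class_eq_iff)
  qed
  assume Z: "Z \<in> carrier (L0_ext M)" 
  show "X \<sqsubseteq>\<^bsub>L0_ext M\<^esub> Z" if "X \<sqsubseteq>\<^bsub>L0_ext M\<^esub> Y" "Y \<sqsubseteq>\<^bsub>L0_ext M\<^esub> Z"
  proof -
    obtain f g h where fg: "f \<in> borel_measurable M" "X = ae_class M f" 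
      "g \<in> borel_measurable M" "Y = ae_class M g"
      "h \<in> borel_measurable M" "Z = ae_class M h"
      using X Y Z by (auto simp: L0_ext_def elim!: ae_classesE)
    have "AE w in M. f w \<le> g w" "AE w in M. g w \<le> h w"
      using that fg by (auto simp: L0_ext_def ae_le_class)
    then have "AE w in M. f w \<le> h w" by eventually_elim auto
    then show ?thesis using fg by (auto simp: L0_ext_def ae_le_class)
  qed
qed (auto simp: L0_ext_def)

lemma complete_lattice_L0_ext:
  assumes "prob_space M"
  shows "complete_lattice (L0_ext M)"
proof -
  interpret partial_order "L0_ext M" by (rule partial_order_L0_ext)
  have "\<exists>i. greatest (L0_ext M) i (Lower (L0_ext M) A)" if A: "A \<subseteq> carrier (L0_ext M)" for A
  proof -
    obtain s where s: "least (L0_ext M) s (Upper (L0_ext M) (Lower (L0_ext M) A))"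
      using L0_ext_sup_exists[OF assms, of "Lower (L0_ext M) A"] by auto
    then have sc: "s \<in> carrier (L0_ext M)" by (auto simp: least_def Upper_def)
    have "greatest (L0_ext M) s (Lower (L0_ext M) A)"
      unfolding greatest_def
    proof (intro conjI ballI)
      have "s \<sqsubseteq>\<^bsub>L0_ext M\<^esub> a" if "a \<in> A" for a
      proof -
        have "a \<in> Upper (L0_ext M) (Lower (L0_ext M) A)"
          using that A by (auto simp: Upper_def Lower_def)
        then show ?thesis using s by (auto simp: least_def)
      qed
      then show "s \<in> Lower (L0_ext M) A" using sc by (auto simp: Lower_def)
      show "x \<sqsubseteq>\<^bsub>L0_ext M\<^esub> s" if "x \<in> Lower (L0_ext M) A" for x
        using s that by (auto simp: least_def Upper_def Lower_def)
    qed auto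
    then show ?thesis by blast
  qed
  then show ?thesis
    using L0_ext_sup_exists[OF assms] by (intro complete_latticeI) auto
qed

abbreviation L0_embed :: "'w measure \<Rightarrow> ('w \<Rightarrow> real) set \<Rightarrow> ('w \<Rightarrow> ereal) set" where
  "L0_embed M \<equiv> ae_map M ereal"

definition L0_seminorm ::
    "'w measure \<Rightarrow> (('w \<Rightarrow> real) set, 'e, 'm) module_scheme \<Rightarrow> ('e \<Rightarrow> ('w \<Rightarrow> real) set) \<Rightarrow> bool" where
  "L0_seminorm M E q \<longleftrightarrow> q \<in> carrier E \<rightarrow> L0_nonneg M \<and>
     (\<forall>\<xi>\<in>carrier (L0 M). \<forall>x\<in>carrier E. q (\<xi> \<odot>\<^bsub>E\<^esub> x) = ae_map M abs \<xi> \<otimes>\<^bsub>L0 M\<^esub> q x) \<and>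
     (\<forall>x\<in>carrier E. \<forall>y\<in>carrier E. ae_le M (q (x \<oplus>\<^bsub>E\<^esub> y)) (q x \<oplus>\<^bsub>L0 M\<^esub> q y))"

text \<open>The supremum is taken in the extended lattice, as a family of seminorms may be unbounded.\<close>

definition family_norm ::
    "'w measure \<Rightarrow> ('e \<Rightarrow> ('w \<Rightarrow> real) set) set \<Rightarrow> 'e \<Rightarrow> ('w \<Rightarrow> ereal) set" where
  "family_norm M Q x = \<Squnion>\<^bsub>L0_ext M\<^esub> ((\<lambda>q. L0_embed M (q x)) ` Q)"

locale random_locally_convex_module =
  prob_space M + E: Module.module "L0 M" E
  for M :: "'w measure" and E :: "(('w \<Rightarrow> real) set, 'e, 'm) module_scheme" +
  fixes P :: "('e \<Rightarrow> ('w \<Rightarrow> real) set) set"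
  assumes seminorms: "\<And>q. q \<in> P \<Longrightarrow> L0_seminorm M E q"
    and separating: "\<And>x. x \<in> carrier E \<Longrightarrow>
      family_norm M P x = ae_class M (\<lambda>_. 0) \<longleftrightarrow> x = \<zero>\<^bsub>E\<^esub>"

lemma random_locally_convex_module_L0:
  assumes "prob_space M"
  shows "random_locally_convex_module M (L0 M) {ae_map M abs}"
proof -
  interpret prob_space M by fact
  interpret L: complete_lattice "L0_ext M"
    by (intro complete_lattice_L0_ext assms)
  interpret R: Module.module "L0 M" "L0 M" by (rule module_L0)
  show ?thesis
  proof
    fix q assume "q \<in> {ae_map M (abs :: real \<Rightarrow> real)}"
    then show "L0_seminorm M (L0 M) q"
      by (auto simp: L0_seminorm_def L0_nonneg_def L0_def ae_map_class ae_map2_class ae_all_class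
          ae_le_class abs_mult abs_triangle_ineq elim!: ae_classesE)
  next
    fix x assume "x \<in> carrier (L0 M)"
    then obtain f where f: "f \<in> borel_measurable M" "x = ae_class M f"
      by (auto simp: L0_def elim: ae_classesE)
    let ?a = "ae_class M (\<lambda>w. ereal \<bar>f w\<bar>)"
    have a: "?a \<in> carrier (L0_ext M)" using f by (auto simp: L0_ext_def)
    have "least (L0_ext M) (\<Squnion>\<^bsub>L0_ext M\<^esub>{?a}) (Upper (L0_ext M) {?a})"
      using a by (intro L.sup_lub) auto
    moreover have "least (L0_ext M) ?a (Upper (L0_ext M) {?a})"
      using a by (auto simp: least_def Upper_def)
    ultimately have "\<Squnion>\<^bsub>L0_ext M\<^esub>{?a} = ?a" by (rule L.least_unique)
    then have "family_norm M {ae_map M abs} x = ?a"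
      using f by (simp add: family_norm_def ae_map_class)
    then show "(family_norm M {ae_map M abs} x = ae_class M (\<lambda>_. 0)) = (x = \<zero>\<^bsub>L0 M\<^esub>)"
      using f by (simp add: L0_def ae_class_eq_iff)
  qed
qed

definition L0_ball ::
    "'w measure \<Rightarrow> (('w \<Rightarrow> real) set, 'e, 'm) module_scheme \<Rightarrow>
     ('e \<Rightarrow> ('w \<Rightarrow> real) set) set \<Rightarrow> ('w \<Rightarrow> real) set \<Rightarrow> 'e set" where
  "L0_ball M E Q \<epsilon> = {x \<in> carrier E. ae_le M (family_norm M Q x) (L0_embed M \<epsilon>)}"

text \<open>The translation-invariant topology whose neighbourhood base at zero consists of these balls.\<close>

definition Tc_open ::
    "'w measure \<Rightarrow> (('w \<Rightarrow> real) set, 'e, 'm) module_scheme \<Rightarrow>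
     ('e \<Rightarrow> ('w \<Rightarrow> real) set) set \<Rightarrow> 'e set \<Rightarrow> bool" where
  "Tc_open M E P U \<longleftrightarrow> U \<subseteq> carrier E \<and>
     (\<forall>x\<in>U. \<exists>Q \<epsilon>. Q \<subseteq> P \<and> finite Q \<and> \<epsilon> \<in> L0_pos M \<and>
        (\<forall>y\<in>L0_ball M E Q \<epsilon>. x \<oplus>\<^bsub>E\<^esub> y \<in> U))"

definition Tc ::
    "'w measure \<Rightarrow> (('w \<Rightarrow> real) set, 'e, 'm) module_scheme \<Rightarrow>
     ('e \<Rightarrow> ('w \<Rightarrow> real) set) set \<Rightarrow> 'e topology" where
  "Tc M E P = topology (Tc_open M E P)"

lemma (in random_locally_convex_module) L0_embed_seminorm:
  assumes "q \<in> P" "x \<in> carrier E"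
  shows "L0_embed M (q x) \<in> carrier (L0_ext M)"
proof -
  have "q x \<in> ae_classes M"
    using seminorms[OF assms(1)] assms(2) by (auto simp: L0_seminorm_def L0_nonneg_def L0_def)
  then show ?thesis
    by (auto simp: L0_ext_def ae_map_class elim!: ae_classesE)
qed

lemma (in random_locally_convex_module) mem_L0_ball_iff:
  assumes "Q \<subseteq> P" "\<epsilon> \<in> carrier (L0 M)"
  shows "x \<in> L0_ball M E Q \<epsilon> \<longleftrightarrow> x \<in> carrier E \<and> (\<forall>q\<in>Q. ae_le M (q x) \<epsilon>)"
proof (cases "x \<in> carrier E")
  case x: True
  interpret L: complete_lattice "L0_ext M"
    by (intro complete_lattice_L0_ext prob_space_axioms)
  let ?A = "(\<lambda>q. L0_embed M (q x)) ` Q"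
  have A: "?A \<subseteq> carrier (L0_ext M)" using L0_embed_seminorm x assms by auto
  obtain e where e: "e \<in> borel_measurable M" "\<epsilon> = ae_class M e"
    using assms by (auto simp: L0_def elim: ae_classesE)
  have ec: "L0_embed M \<epsilon> \<in> carrier (L0_ext M)"
    using e by (auto simp: L0_ext_def ae_map_class)
  have le: "le (L0_ext M) = ae_le M" by (simp add: L0_ext_def)
  have "ae_le M (family_norm M Q x) (L0_embed M \<epsilon>) \<longleftrightarrow>
      (\<forall>q\<in>Q. ae_le M (L0_embed M (q x)) (L0_embed M \<epsilon>))"
  proof
    assume B: "ae_le M (family_norm M Q x) (L0_embed M \<epsilon>)"
    show "\<forall>q\<in>Q. ae_le M (L0_embed M (q x)) (L0_embed M \<epsilon>)"
    proof
      fix q assume q: "q \<in> Q"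
      have "L0_embed M (q x) \<sqsubseteq>\<^bsub>L0_ext M\<^esub> family_norm M Q x"
        unfolding family_norm_def by (rule L.sup_upper[OF A]) (use q in auto)
      moreover have "family_norm M Q x \<in> carrier (L0_ext M)"
        unfolding family_norm_def by (rule L.sup_closed[OF A])
      ultimately show "ae_le M (L0_embed M (q x)) (L0_embed M \<epsilon>)"
        using L.le_trans[of "L0_embed M (q x)" "family_norm M Q x" "L0_embed M \<epsilon>"] A q B ec
        by (auto simp: le)
    qed
  next
    assume "\<forall>q\<in>Q. ae_le M (L0_embed M (q x)) (L0_embed M \<epsilon>)"
    then show "ae_le M (family_norm M Q x) (L0_embed M \<epsilon>)"
      using L.sup_least[OF A, of "L0_embed M \<epsilon>"] ec by (auto simp: le family_norm_def)
  qed
  moreover have "ae_le M (L0_embed M (q x)) (L0_embed M \<epsilon>) \<longleftrightarrow> ae_le M (q x) \<epsilon>" if "q \<in> Q" for q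
  proof -
    have "q x \<in> ae_classes M"
      using seminorms[of q] subsetD[OF assms(1) that] x by (auto simp: L0_seminorm_def L0_nonneg_def L0_def)
    then show ?thesis using e by (auto simp: ae_map_class ae_le_class elim!: ae_classesE)
  qed
  ultimately show ?thesis using x by (simp add: L0_ball_def)
qed (simp add: L0_ball_def)

lemma (in random_locally_convex_module) L0_ball_inter:
  assumes "Q1 \<subseteq> P" "Q2 \<subseteq> P" "\<epsilon>1 \<in> L0_pos M" "\<epsilon>2 \<in> L0_pos M"
  obtains \<epsilon> where "\<epsilon> \<in> L0_pos M"
    "L0_ball M E (Q1 \<union> Q2) \<epsilon> \<subseteq> L0_ball M E Q1 \<epsilon>1 \<inter> L0_ball M E Q2 \<epsilon>2"
proof -
  obtain e1 e2 where e: "e1 \<in> borel_measurable M" "\<epsilon>1 = ae_class M e1"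
      "e2 \<in> borel_measurable M" "\<epsilon>2 = ae_class M e2"
    using assms by (auto simp: L0_pos_def L0_def elim!: ae_classesE)
  define e where "e w = min (e1 w) (e2 w)" for w
  define \<epsilon> where "\<epsilon> = ae_class M e"
  have em: "e \<in> borel_measurable M" unfolding e_def using e by measurable
  have "AE w in M. 0 < e1 w" "AE w in M. 0 < e2 w"
    using assms e by (auto simp: L0_pos_def ae_all_class)
  then have "AE w in M. 0 < e w" by eventually_elim (auto simp: e_def)
  then have pos: "\<epsilon> \<in> L0_pos M"
    using em by (auto simp: L0_pos_def \<epsilon>_def ae_all_class L0_def)
  have "ae_le M (q x) \<epsilon>1 \<and> ae_le M (q x) \<epsilon>2"
    if "q \<in> P" "x \<in> carrier E" "ae_le M (q x) \<epsilon>" for q x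
  proof -
    have "q x \<in> ae_classes M"
      using seminorms[of q] that by (auto simp: L0_seminorm_def L0_nonneg_def L0_def)
    then obtain h where h: "h \<in> borel_measurable M" "q x = ae_class M h" by (rule ae_classesE)
    then have "AE w in M. h w \<le> e w" using that em by (auto simp: ae_le_class \<epsilon>_def)
    then have "AE w in M. h w \<le> e1 w \<and> h w \<le> e2 w" by eventually_elim (auto simp: e_def)
    then show ?thesis using h e by (auto simp: ae_le_class)
  qed
  moreover have "\<epsilon> \<in> carrier (L0 M)" "\<epsilon>1 \<in> carrier (L0 M)" "\<epsilon>2 \<in> carrier (L0 M)"
    using pos assms by (auto simp: L0_pos_def)
  ultimately have "L0_ball M E (Q1 \<union> Q2) \<epsilon> \<subseteq> L0_ball M E Q1 \<epsilon>1 \<inter> L0_ball M E Q2 \<epsilon>2"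
    using assms(1,2) by (fastforce simp: mem_L0_ball_iff)
  with pos that show thesis by blast
qed

lemma (in random_locally_convex_module) istopology_Tc_open: "istopology (Tc_open M E P)"
  unfolding istopology_def
proof (intro conjI allI impI)
  fix S T assume S: "Tc_open M E P S" and T: "Tc_open M E P T"
  show "Tc_open M E P (S \<inter> T)"
    unfolding Tc_open_def
  proof (intro conjI ballI)
    show "S \<inter> T \<subseteq> carrier E" using S by (auto simp: Tc_open_def)
    fix x assume "x \<in> S \<inter> T"
    then obtain Q1 \<epsilon>1 Q2 \<epsilon>2 where
      1: "Q1 \<subseteq> P" "finite Q1" "\<epsilon>1 \<in> L0_pos M" "\<forall>y\<in>L0_ball M E Q1 \<epsilon>1. x \<oplus>\<^bsub>E\<^esub> y \<in> S" and
      2: "Q2 \<subseteq> P" "finite Q2" "\<epsilon>2 \<in> L0_pos M" "\<forall>y\<in>L0_ball M E Q2 \<epsilon>2. x \<oplus>\<^bsub>E\<^esub> y \<in> T"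
      using S T unfolding Tc_open_def by blast
    obtain \<epsilon> where "\<epsilon> \<in> L0_pos M"
      "L0_ball M E (Q1 \<union> Q2) \<epsilon> \<subseteq> L0_ball M E Q1 \<epsilon>1 \<inter> L0_ball M E Q2 \<epsilon>2"
      using L0_ball_inter 1 2 by metis
    with 1 2 show "\<exists>Q \<epsilon>. Q \<subseteq> P \<and> finite Q \<and> \<epsilon> \<in> L0_pos M \<and>
        (\<forall>y\<in>L0_ball M E Q \<epsilon>. x \<oplus>\<^bsub>E\<^esub> y \<in> S \<inter> T)"
      by (intro exI[of _ "Q1 \<union> Q2"] exI[of _ \<epsilon>]) blast
  qed
next
  fix \<K> assume K: "\<forall>K\<in>\<K>. Tc_open M E P K"
  show "Tc_open M E P (\<Union>\<K>)"
    unfolding Tc_open_def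
  proof (intro conjI ballI)
    show "\<Union>\<K> \<subseteq> carrier E" using K by (auto simp: Tc_open_def)
    fix x assume "x \<in> \<Union>\<K>"
    then obtain K where "K \<in> \<K>" "x \<in> K" by blast
    with K show "\<exists>Q \<epsilon>. Q \<subseteq> P \<and> finite Q \<and> \<epsilon> \<in> L0_pos M \<and>
        (\<forall>y\<in>L0_ball M E Q \<epsilon>. x \<oplus>\<^bsub>E\<^esub> y \<in> \<Union>\<K>)"
      unfolding Tc_open_def by (meson UnionI)
  qed
qed

lemma (in random_locally_convex_module) openin_Tc: "openin (Tc M E P) = Tc_open M E P"
  unfolding Tc_def by (rule topology_inverse') (rule istopology_Tc_open)

lemma (in random_locally_convex_module) topspace_Tc: "topspace (Tc M E P) = carrier E"
proof -
  interpret R: cring "L0 M" by (rule cring_L0)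
  have "\<one>\<^bsub>L0 M\<^esub> \<in> L0_pos M"
    by (auto simp: L0_pos_def ae_all_class L0_def)
  then have "Tc_open M E P (carrier E)"
    unfolding Tc_open_def
    by (auto simp: L0_ball_def intro!: exI[of _ "{}"] exI[of _ "\<one>\<^bsub>L0 M\<^esub>"])
  then show ?thesis
    unfolding topspace_def openin_Tc by (auto simp: Tc_open_def)
qed

lemma (in random_locally_convex_module) L0_ball_nhd:
  assumes Q: "Q \<subseteq> P" "finite Q" and \<epsilon>: "\<epsilon> \<in> L0_pos M"
  obtains U where "openin (Tc M E P) U" "\<zero>\<^bsub>E\<^esub> \<in> U" "U \<subseteq> L0_ball M E Q \<epsilon>"
proof -
  have \<epsilon>c: "\<epsilon> \<in> carrier (L0 M)" using \<epsilon> by (simp add: L0_pos_def)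
  then obtain e where e: "e \<in> borel_measurable M" "\<epsilon> = ae_class M e"
    by (auto simp: L0_def elim: ae_classesE)
  have epos: "AE w in M. 0 < e w" using \<epsilon> e by (simp add: L0_pos_def ae_all_class)
  have cls: "q x \<in> ae_classes M" if "q \<in> Q" "x \<in> carrier E" for q x
    using seminorms[of q] subsetD[OF Q(1) that(1)] that(2)
    by (auto simp: L0_seminorm_def L0_nonneg_def L0_def)
  define U where "U = {x \<in> carrier E. \<exists>d\<in>borel_measurable M. (AE w in M. 0 < d w) \<and>
    (\<forall>q\<in>Q. ae_le M (q x) (ae_class M (\<lambda>w. e w - d w)))}"
  have "Tc_open M E P U"
    unfolding Tc_open_def
  proof (intro conjI ballI)
    show "U \<subseteq> carrier E" by (auto simp: U_def)
    fix x assume "x \<in> U"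
    then obtain d where x: "x \<in> carrier E" and d: "d \<in> borel_measurable M" "AE w in M. 0 < d w"
      "\<And>q. q \<in> Q \<Longrightarrow> ae_le M (q x) (ae_class M (\<lambda>w. e w - d w))" by (auto simp: U_def)
    let ?d = "\<lambda>w. d w / 2"
    have dpos: "ae_class M ?d \<in> L0_pos M"
      using d by (auto simp: L0_pos_def ae_all_class L0_def)
    have "x \<oplus>\<^bsub>E\<^esub> y \<in> U" if y: "y \<in> L0_ball M E Q (ae_class M ?d)" for y
    proof -
      have yc: "y \<in> carrier E" and yq: "\<And>q. q \<in> Q \<Longrightarrow> ae_le M (q y) (ae_class M ?d)"
        using y mem_L0_ball_iff[OF Q(1), of "ae_class M ?d" y] d by (auto simp: L0_def)
      have "ae_le M (q (x \<oplus>\<^bsub>E\<^esub> y)) (ae_class M (\<lambda>w. e w - ?d w))" if q: "q \<in> Q" for q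
      proof -
        obtain a b c where abc: "a \<in> borel_measurable M" "q x = ae_class M a"
          "b \<in> borel_measurable M" "q y = ae_class M b"
          "c \<in> borel_measurable M" "q (x \<oplus>\<^bsub>E\<^esub> y) = ae_class M c"
          using cls[OF q x] cls[OF q yc] cls[OF q E.a_closed[OF x yc]] by (metis ae_classesE)
        have "AE w in M. a w \<le> e w - d w" using d(3)[OF q] abc d(1) e by (simp add: ae_le_class)
        moreover have "AE w in M. b w \<le> d w / 2" using yq[OF q] abc d(1) by (simp add: ae_le_class)
        moreover have "ae_le M (q (x \<oplus>\<^bsub>E\<^esub> y)) (q x \<oplus>\<^bsub>L0 M\<^esub> q y)"
          using seminorms[of q] subsetD[OF Q(1) q] x yc by (auto simp: L0_seminorm_def)
        then have "AE w in M. c w \<le> a w + b w"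
          using abc by (simp add: L0_def ae_map2_class ae_le_class)
        ultimately have "AE w in M. c w \<le> e w - d w / 2"
          by eventually_elim (simp add: field_simps)
        then show ?thesis using abc d(1) e by (simp add: ae_le_class)
      qed
      then show ?thesis using x yc d by (auto simp: U_def intro!: bexI[of _ ?d])
    qed
    then show "\<exists>Q \<epsilon>. Q \<subseteq> P \<and> finite Q \<and> \<epsilon> \<in> L0_pos M \<and>
        (\<forall>y\<in>L0_ball M E Q \<epsilon>. x \<oplus>\<^bsub>E\<^esub> y \<in> U)"
      using Q dpos by blast
  qed
  moreover have "\<zero>\<^bsub>E\<^esub> \<in> U"
  proof -
    have "ae_le M (q \<zero>\<^bsub>E\<^esub>) (ae_class M (\<lambda>w. e w - e w / 2))" if q: "q \<in> Q" for q
    proof -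
      obtain a where a: "a \<in> borel_measurable M" "q \<zero>\<^bsub>E\<^esub> = ae_class M a"
        using cls[OF q E.zero_closed] by (metis ae_classesE)
      have z: "ae_class M (\<lambda>_. 0) \<in> carrier (L0 M)" by (simp add: L0_def)
      have "q (ae_class M (\<lambda>_. 0) \<odot>\<^bsub>E\<^esub> \<zero>\<^bsub>E\<^esub>) =
          ae_map M abs (ae_class M (\<lambda>_. 0)) \<otimes>\<^bsub>L0 M\<^esub> q \<zero>\<^bsub>E\<^esub>"
        using seminorms[OF subsetD[OF Q(1) q]] z E.zero_closed unfolding L0_seminorm_def by blast
      also have "ae_class M (\<lambda>_. 0) \<odot>\<^bsub>E\<^esub> \<zero>\<^bsub>E\<^esub> = \<zero>\<^bsub>E\<^esub>" using z by simp
      finally have "AE w in M. a w = 0"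
        using a by (simp add: L0_def ae_map_class ae_map2_class ae_class_eq_iff)
      then have "AE w in M. a w \<le> e w - e w / 2" using epos by eventually_elim simp
      then show ?thesis using a e by (simp add: ae_le_class)
    qed
    then show ?thesis using e epos by (auto simp: U_def intro!: bexI[of _ "\<lambda>w. e w / 2"])
  qed
  moreover have "U \<subseteq> L0_ball M E Q \<epsilon>"
  proof
    fix x assume "x \<in> U"
    then obtain d where x: "x \<in> carrier E" and d: "d \<in> borel_measurable M" "AE w in M. 0 < d w"
      "\<And>q. q \<in> Q \<Longrightarrow> ae_le M (q x) (ae_class M (\<lambda>w. e w - d w))" by (auto simp: U_def)
    have "ae_le M (q x) \<epsilon>" if q: "q \<in> Q" for q
    proof -
      obtain a where a: "a \<in> borel_measurable M" "q x = ae_class M a"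
        using cls[OF q x] by (metis ae_classesE)
      have "AE w in M. a w \<le> e w - d w" using d(3)[OF q] a d(1) e by (simp add: ae_le_class)
      then have "AE w in M. a w \<le> e w" using d(2) by eventually_elim simp
      then show ?thesis using a e by (simp add: ae_le_class)
    qed
    then show "x \<in> L0_ball M E Q \<epsilon>" using x by (simp add: mem_L0_ball_iff[OF Q(1) \<epsilon>c])
  qed
  ultimately show thesis using that openin_Tc by metis
qed

definition Tc_dual ::
    "'w measure \<Rightarrow> (('w \<Rightarrow> real) set, 'e, 'm) module_scheme \<Rightarrow>
     ('e \<Rightarrow> ('w \<Rightarrow> real) set) set \<Rightarrow> ('e \<Rightarrow> ('w \<Rightarrow> real) set) set" where
  "Tc_dual M E P = {g \<in> carrier E \<rightarrow> carrier (L0 M).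
     (\<forall>x\<in>carrier E. \<forall>y\<in>carrier E. g (x \<oplus>\<^bsub>E\<^esub> y) = g x \<oplus>\<^bsub>L0 M\<^esub> g y) \<and>
     (\<forall>\<xi>\<in>carrier (L0 M). \<forall>x\<in>carrier E. g (\<xi> \<odot>\<^bsub>E\<^esub> x) = \<xi> \<otimes>\<^bsub>L0 M\<^esub> g x) \<and>
     continuous_map (Tc M E P) (Tc M (L0 M) {ae_map M abs}) g}"

text \<open>Members of a partition may be empty, which covers finite partitions.\<close>

definition countable_concatenation ::
    "'w measure \<Rightarrow> (('w \<Rightarrow> real) set, 'e, 'm) module_scheme \<Rightarrow> bool" where
  "countable_concatenation M E \<longleftrightarrow>
     (\<forall>(x :: nat \<Rightarrow> 'e) A. range x \<subseteq> carrier E \<and> range A \<subseteq> sets M \<and> disjoint_family A \<and>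
        (\<Union>n. A n) = space M \<longrightarrow>
        (\<exists>y\<in>carrier E. \<forall>n. L0_indicator M (A n) \<odot>\<^bsub>E\<^esub> y = L0_indicator M (A n) \<odot>\<^bsub>E\<^esub> x n))"

definition L0_dom ::
    "'w measure \<Rightarrow> ('x, 'e, 'm) module_scheme \<Rightarrow> ('e \<Rightarrow> ('w \<Rightarrow> ereal) set) \<Rightarrow> 'e set" where
  "L0_dom M E f = {x \<in> carrier E. ae_all M (\<lambda>t. \<bar>t\<bar> < \<infinity>) (f x)}"

definition L0_proper ::
    "'w measure \<Rightarrow> ('x, 'e, 'm) module_scheme \<Rightarrow> ('e \<Rightarrow> ('w \<Rightarrow> ereal) set) \<Rightarrow> bool" where
  "L0_proper M E f \<longleftrightarrow> L0_dom M E f \<noteq> {} \<and> (\<forall>x\<in>carrier E. ae_all M (\<lambda>t. t > -\<infinity>) (f x))"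

text \<open>
  The arithmetic of \<^typ>\<open>ereal\<close> agrees with the conventions \<open>0 \<cdot> (\<plusminus>\<infinity>) = 0\<close> and
  \<open>\<infinity> \<plusminus> (\<plusminus>\<infinity>) = \<infinity>\<close>.
\<close>

definition L0_convex ::
    "'w measure \<Rightarrow> (('w \<Rightarrow> real) set, 'e, 'm) module_scheme \<Rightarrow>
     ('e \<Rightarrow> ('w \<Rightarrow> ereal) set) \<Rightarrow> bool" where
  "L0_convex M E f \<longleftrightarrow>
     (\<forall>x\<in>carrier E. \<forall>y\<in>carrier E. \<forall>\<xi>\<in>L0_nonneg M. ae_le M \<xi> \<one>\<^bsub>L0 M\<^esub> \<longrightarrow>
        ae_le M (f (\<xi> \<odot>\<^bsub>E\<^esub> x \<oplus>\<^bsub>E\<^esub> (\<one>\<^bsub>L0 M\<^esub> \<ominus>\<^bsub>L0 M\<^esub> \<xi>) \<odot>\<^bsub>E\<^esub> y))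
          (ae_map2 M (+) (ae_map2 M (*) (L0_embed M \<xi>) (f x))
             (ae_map2 M (*) (L0_embed M (\<one>\<^bsub>L0 M\<^esub> \<ominus>\<^bsub>L0 M\<^esub> \<xi>)) (f y))))"

definition Tc_lsc ::
    "'w measure \<Rightarrow> (('w \<Rightarrow> real) set, 'e, 'm) module_scheme \<Rightarrow>
     ('e \<Rightarrow> ('w \<Rightarrow> real) set) set \<Rightarrow> ('e \<Rightarrow> ('w \<Rightarrow> ereal) set) \<Rightarrow> bool" where
  "Tc_lsc M E P f \<longleftrightarrow>
     (\<forall>r\<in>carrier (L0 M). closedin (Tc M E P) {x \<in> carrier E. ae_le M (f x) (L0_embed M r)})"

definition Tc_conjugate ::
    "'w measure \<Rightarrow> (('w \<Rightarrow> real) set, 'e, 'm) module_scheme \<Rightarrow>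
     ('e \<Rightarrow> ('w \<Rightarrow> ereal) set) \<Rightarrow> ('e \<Rightarrow> ('w \<Rightarrow> real) set) \<Rightarrow> ('w \<Rightarrow> ereal) set" where
  "Tc_conjugate M E f g =
     \<Squnion>\<^bsub>L0_ext M\<^esub> ((\<lambda>x. ae_map2 M (-) (L0_embed M (g x)) (f x)) ` carrier E)"

definition Tc_biconjugate ::
    "'w measure \<Rightarrow> (('w \<Rightarrow> real) set, 'e, 'm) module_scheme \<Rightarrow>
     ('e \<Rightarrow> ('w \<Rightarrow> real) set) set \<Rightarrow> ('e \<Rightarrow> ('w \<Rightarrow> ereal) set) \<Rightarrow> 'e \<Rightarrow> ('w \<Rightarrow> ereal) set" where
  "Tc_biconjugate M E P f x =
     \<Squnion>\<^bsub>L0_ext M\<^esub> ((\<lambda>g. ae_map2 M (-) (L0_embed M (g x)) (Tc_conjugate M E f g)) ` Tc_dual M E P)"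

end

theory Submission
  imports Defs
begin

text \<open>
  If \<open>f\<^sup>*\<^sup>*(x) < f(x)\<close> on a set of positive measure, there is a rational \<open>r\<close> with
  \<open>f\<^sup>*\<^sup>*(x) < r < f(x)\<close> on such a set \<open>B\<close>.  Only a subset of \<open>B\<close> of positive measure is needed
  for the contradiction, so one finite set \<open>Q\<close> of seminorms suffices and the family of seminorms
  itself need not be closed under countable concatenation.  Lower semicontinuity gives a ball
  around \<open>x\<close> (modified off \<open>B\<close>) missing a sublevel set of \<open>f\<close>; by countable concatenation the
  largest set on which some point of the ball lies in the sublevel set is attained, hence on its
  complement \<open>f > r\<close> holds throughout the ball.  Applying this first at a point of the domain, where
  convexity turns it into a global minorant \<open>c - K \<parallel>\<cdot>\<parallel>\<^sub>Q\<close>, and then at \<open>x\<close>, one obtains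
  \<open>f(y) \<ge> r - K \<parallel>y - x\<parallel>\<^sub>Q\<close> on a set of positive measure.  A sandwich theorem then yields a
  continuous homomorphism \<open>g\<close> with \<open>g(y) - g(x) + r \<le> f(y)\<close>, that is \<open>g(x) - f\<^sup>*(g) \<ge> r\<close> there.
\<close>

section \<open>Representatives and essential bounds\<close>

text \<open>The order of L^0 is only partial: if f(x) is not below its biconjugate, this says
  something on a set of positive measure and nothing elsewhere. That is harmless, since a functional
  only has to do its job on some B': off B' its conjugate may be arbitrarily large, even
  \<infinity>. So the bounds are stated on a set that may shrink from step to step but keeps
  positive measure. L^0 is also not a field. A scalar may vanish on part of the space, so one can
  divide by it only on its support and must patch the result elsewhere with another vector. The
  detour through the domain has its reason in f(x) = \<infinity>. Lower semicontinuity controls f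
  only inside a ball around x, and convexity along segments that start at x says nothing outside the
  ball if f(x) is infinite. Segments that start at a point of finite value do give a bound with
  linear growth, and its deficit at x is then absorbed into a larger random slope K.\<close>

definition rep :: "'w measure \<Rightarrow> ('w \<Rightarrow> 'b::topological_space) set \<Rightarrow> 'w \<Rightarrow> 'b" where
  "rep M X = (SOME h. h \<in> borel_measurable M \<and> X = ae_class M h)"

lemma
  assumes "X \<in> ae_classes M"
  shows rep_measurable [measurable (raw)]: "rep M X \<in> borel_measurable M"
    and ae_class_rep [simp]: "ae_class M (rep M X) = X"
proof -
  have "\<exists>h. h \<in> borel_measurable M \<and> X = ae_class M h"
    using assms by (auto simp: ae_classes_def)
  then have "rep M X \<in> borel_measurable M \<and> X = ae_class M (rep M X)"
    unfolding rep_def by (rule someI_ex)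
  then show "rep M X \<in> borel_measurable M" "ae_class M (rep M X) = X" by auto
qed

lemma rep_ae_class:
  assumes "h \<in> borel_measurable M"
  shows "AE w in M. rep M (ae_class M h) w = h w"
  using ae_class_rep[OF ae_class_in[OF assms]] ae_class_eq_iff[OF rep_measurable[OF ae_class_in[OF assms]] assms]
  by simp

lemma L0_one_minus:
  assumes "\<phi> \<in> borel_measurable M"
  shows "\<one>\<^bsub>L0 M\<^esub> \<ominus>\<^bsub>L0 M\<^esub> ae_class M \<phi> = ae_class M (\<lambda>w. 1 - \<phi> w)"
proof -
  interpret R: cring "L0 M" by (rule cring_L0)
  have "ae_class M (\<lambda>w. - \<phi> w) \<oplus>\<^bsub>L0 M\<^esub> ae_class M \<phi> = \<zero>\<^bsub>L0 M\<^esub>"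
    using assms by (simp add: L0_def ae_map2_class)
  then have "\<ominus>\<^bsub>L0 M\<^esub> ae_class M \<phi> = ae_class M (\<lambda>w. - \<phi> w)"
    using assms by (intro R.minus_equality) (auto simp: L0_def)
  then show ?thesis
    using assms by (simp add: R.minus_eq) (simp add: L0_def ae_map2_class)
qed

text \<open>Lattice suprema turned into a.e. inequalities between functions. The exceptional null
  set depends on \<open>i\<close>; as \<open>I\<close> may be uncountable, the bounds are asserted
  one index at a time.\<close>

lemma (in prob_space) L0_ext_Sup:
  assumes h: "\<And>i. i \<in> I \<Longrightarrow> h i \<in> borel_measurable M"
    and S: "S = \<Squnion>\<^bsub>L0_ext M\<^esub>((\<lambda>i. ae_class M (h i)) ` I)"
  shows "S \<in> ae_classes M"
    and "\<And>i. i \<in> I \<Longrightarrow> AE w in M. h i w \<le> rep M S w"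
    and "\<And>u. u \<in> borel_measurable M \<Longrightarrow> (\<And>i. i \<in> I \<Longrightarrow> AE w in M. h i w \<le> u w) \<Longrightarrow>
      AE w in M. rep M S w \<le> u w"
proof -
  interpret L: complete_lattice "L0_ext M"
    by (intro complete_lattice_L0_ext prob_space_axioms)
  have leq: "le (L0_ext M) = ae_le M" and car: "carrier (L0_ext M) = ae_classes M"
    by (simp_all add: L0_ext_def)
  have sub: "(\<lambda>i. ae_class M (h i)) ` I \<subseteq> carrier (L0_ext M)" using h by (auto simp: car)
  show Sc: "S \<in> ae_classes M" using L.sup_closed[OF sub] by (simp add: S car)
  note Sr = rep_measurable[OF Sc] ae_class_rep[OF Sc]
  show "AE w in M. h i w \<le> rep M S w" if i: "i \<in> I" for i
  proof -
    have "ae_le M (ae_class M (h i)) S"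
      using L.sup_upper[OF sub, of "ae_class M (h i)"] i by (simp add: S leq)
    then have "ae_le M (ae_class M (h i)) (ae_class M (rep M S))" using Sr by simp
    then show ?thesis using ae_le_class[OF h[OF i] Sr(1)] by simp
  qed
  show "AE w in M. rep M S w \<le> u w"
    if u: "u \<in> borel_measurable M" "\<And>i. i \<in> I \<Longrightarrow> AE w in M. h i w \<le> u w" for u
  proof -
    have "le (L0_ext M) S (ae_class M u)"
      unfolding S by (rule L.sup_least[OF sub]) (use u h in \<open>auto simp: leq car ae_le_class\<close>)
    then have "ae_le M (ae_class M (rep M S)) (ae_class M u)" using Sr by (simp add: leq)
    then show ?thesis using ae_le_class[OF Sr(1) u(1)] by simp
  qed
qed

text \<open>The infimum is taken in the extended lattice. The lower bound \<open>l\<close> and a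
  member of \<open>H\<close> squeeze it between two real functions, so it has a real
  representative.\<close>

lemma (in prob_space) ex_essential_Inf:
  fixes H :: "('a \<Rightarrow> real) set"
  assumes H: "H \<subseteq> borel_measurable M" "H \<noteq> {}"
    and l: "l \<in> borel_measurable M" "\<And>h. h \<in> H \<Longrightarrow> AE w in M. l w \<le> h w"
  obtains a where "a \<in> borel_measurable M" "\<And>h. h \<in> H \<Longrightarrow> AE w in M. a w \<le> h w"
    "\<And>b. b \<in> borel_measurable M \<Longrightarrow> (\<And>h. h \<in> H \<Longrightarrow> AE w in M. b w \<le> h w) \<Longrightarrow> AE w in M. b w \<le> a w"
proof -
  interpret L: complete_lattice "L0_ext M"
    by (intro complete_lattice_L0_ext prob_space_axioms)
  have leq: "le (L0_ext M) = ae_le M" and car: "carrier (L0_ext M) = ae_classes M"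
    by (simp_all add: L0_ext_def)
  let ?c = "\<lambda>h. ae_class M (\<lambda>w. ereal (h w))"
  let ?I = "\<Sqinter>\<^bsub>L0_ext M\<^esub>(?c ` H)"
  have sub: "?c ` H \<subseteq> carrier (L0_ext M)" using H by (auto simp: car)
  then have "?I \<in> ae_classes M" using L.inf_closed car by auto
  then obtain k where k: "k \<in> borel_measurable M" "?I = ae_class M k" by (rule ae_classesE)
  have low: "AE w in M. k w \<le> ereal (h w)" if "h \<in> H" for h
    using L.inf_lower[OF sub, of "?c h"] that H k by (auto simp: leq ae_le_class)
  have gr: "AE w in M. ereal (b w) \<le> k w"
    if "b \<in> borel_measurable M" "\<And>h. h \<in> H \<Longrightarrow> AE w in M. b w \<le> h w" for b
  proof -
    have "le (L0_ext M) (?c b) ?I"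
      by (rule L.inf_greatest[OF sub]) (use that H in \<open>auto simp: leq car ae_le_class\<close>)
    then show ?thesis using that k by (auto simp: leq ae_le_class)
  qed
  obtain h0 where h0: "h0 \<in> H" using H by auto
  have "AE w in M. ereal (l w) \<le> k w" by (rule gr) (use l in auto)
  then have fin: "AE w in M. ereal (real_of_ereal (k w)) = k w"
    using low[OF h0]
  proof eventually_elim
    case (elim w)
    then show ?case by (cases "k w") auto
  qed
  show thesis
  proof (rule that[of "\<lambda>w. real_of_ereal (k w)"])
    show "AE w in M. real_of_ereal (k w) \<le> h w" if "h \<in> H" for h
      using fin low[OF that] by eventually_elim (metis ereal_less_eq(3))
    show "AE w in M. b w \<le> real_of_ereal (k w)"
      if "b \<in> borel_measurable M" "\<And>h. h \<in> H \<Longrightarrow> AE w in M. b w \<le> h w" for b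
    proof -
      have "AE w in M. ereal (b w) \<le> k w" by (rule gr) (use that in auto)
      with fin show ?thesis by eventually_elim (metis ereal_less_eq(3))
    qed
  qed (use k in measurable)
qed

text \<open>Exhaustion: the measures of countable unions have a supremum, which is attained because
  countably many sequences merge into one. Adjoining a further member to an optimal sequence cannot
  increase the measure, so what it adds is null.\<close>

lemma (in finite_measure) countable_union_ae_cover:
  assumes A: "\<A> \<subseteq> sets M" "\<A> \<noteq> {}"
  obtains N :: "nat \<Rightarrow> 'a set" where "range N \<subseteq> \<A>"
    "\<forall>B\<in>\<A>. AE w in M. w \<in> B \<longrightarrow> w \<in> (\<Union>n. N n)"
proof -
  let ?m = "\<lambda>N::nat \<Rightarrow> 'a set. measure M (\<Union>n. N n)"
  define S where "S = {N::nat \<Rightarrow> 'a set. range N \<subseteq> \<A>}"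
  define s where "s = (SUP N\<in>S. ?m N)"
  obtain B0 where "B0 \<in> \<A>" using A by auto
  then have ne: "S \<noteq> {}" by (auto simp: S_def intro!: exI[of _ "\<lambda>_. B0"])
  have bdd: "bdd_above (?m ` S)"
    using bounded_measure by (auto simp: bdd_above_def)
  have "\<exists>N\<in>S. s - 1 / Suc n < ?m N" for n
    using less_cSUP_iff[OF ne bdd, of "s - 1 / Suc n"] by (simp add: s_def)
  then obtain N where N: "\<And>n. N n \<in> S" "\<And>n. s - 1 / Suc n < ?m (N n)" by metis
  define K where "K i = N (fst (prod_decode i)) (snd (prod_decode i))" for i
  have KS: "K \<in> S" using N(1) by (auto simp: S_def K_def)
  have KN: "(\<Union>i. N n i) \<subseteq> (\<Union>i. K i)" for n
  proof
    fix w assume "w \<in> (\<Union>i. N n i)"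
    then obtain i where "w \<in> N n i" by auto
    then show "w \<in> (\<Union>i. K i)" by (auto simp: K_def intro!: exI[of _ "prod_encode (n, i)"])
  qed
  have "K i \<in> sets M" for i using KS A by (auto simp: S_def)
  then have Km: "(\<Union>i. K i) \<in> sets M" by auto
  have sK: "s \<le> ?m K"
  proof (rule field_le_epsilon)
    fix e :: real assume "e > 0"
    then obtain n where "1 / Suc n < e" using nat_approx_posE by metis
    moreover have "?m (N n) \<le> ?m K" by (rule finite_measure_mono[OF KN Km])
    ultimately show "s \<le> ?m K + e" using N(2)[of n] by linarith
  qed
  show thesis
  proof (rule that; (rule ballI)?)
    show "range K \<subseteq> \<A>" using KS by (simp add: S_def)
    fix B assume B: "B \<in> \<A>"
    \<comment> \<open>Putting \<open>B\<close> in front of the optimal sequence gives another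
      admissible sequence.\<close>
    let ?K = "case_nat B K"
    have U: "(\<Union>i. ?K i) = (\<Union>i. K i) \<union> B"
    proof (intro equalityI subsetI)
      fix w assume "w \<in> (\<Union>i. K i) \<union> B"
      then consider i where "w \<in> ?K (Suc i)" | "w \<in> ?K 0" by auto
      then show "w \<in> (\<Union>i. ?K i)" by cases blast+
    next
      fix w assume "w \<in> (\<Union>i. ?K i)"
      then obtain i where "w \<in> ?K i" by blast
      then show "w \<in> (\<Union>i. K i) \<union> B" by (cases i) auto
    qed
    have "K i \<in> \<A>" for i using KS by (auto simp: S_def)
    then have "?K \<in> S" using B by (auto simp: S_def split: nat.splits)
    then have "?m ?K \<le> s" unfolding s_def by (rule cSUP_upper[OF _ bdd])
    moreover have Bm: "B \<in> sets M" using B A by auto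
    ultimately have "measure M ((\<Union>i. K i) \<union> (B - (\<Union>i. K i))) \<le> ?m K" using sK U by simp
    then have "measure M (B - (\<Union>i. K i)) = 0"
      using Km Bm finite_measure_Union[of "\<Union>i. K i" "B - (\<Union>i. K i)"]
      by (auto intro: antisym[OF _ measure_nonneg])
    then have "B - (\<Union>i. K i) \<in> null_sets M"
      using Km Bm by (intro null_setsI) (auto simp: emeasure_eq_measure)
    then show "AE w in M. w \<in> B \<longrightarrow> w \<in> (\<Union>i. K i)" by (rule AE_I') auto
  qed
qed

section \<open>Perspectives of convex functions with extended real values\<close>

text \<open>Subadditivity of the perspective \<phi> F(v / \<phi>), where \<open>c\<close> stands for
  the value of F at the combination with weight \<open>s / (s + t)\<close>. A positive scalar forces
  the corresponding value \<open>a\<close> or \<open>b\<close> to be real, a vanishing one cancels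
  it even if it is infinite. For \<open>s = t = 0\<close> the weight is the default value 0 of the
  division, but then the factor \<open>s + t\<close> removes \<open>c\<close>.\<close>

lemma ereal_perspective_add:
  fixes a b c :: ereal and s t u v h k :: real
  assumes "0 \<le> s" "0 \<le> t" "-\<infinity> < a" "-\<infinity> < b"
    and c: "c \<le> ereal (s / (s + t)) * a + ereal (1 - s / (s + t)) * b"
    and a: "ereal s * a + ereal u \<le> ereal h" and b: "ereal t * b + ereal v \<le> ereal k"
    and z: "z \<le> u + v"
  shows "ereal (s + t) * c + ereal z \<le> ereal (h + k)"
proof -
  consider "s = 0" "t = 0" | "s > 0" "t = 0" | "s = 0" "t > 0" | "s > 0" "t > 0"
    using assms by linarith
  then show ?thesis
  proof cases
    case 1
    then show ?thesis using a b z by (simp flip: zero_ereal_def)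
  next
    case 2
    then obtain x where x: "a = ereal x" using a assms(3) by (cases a) auto
    then have "c \<le> ereal x" "s * x + u \<le> h" "v \<le> k"
      using 2 a b c by (simp_all flip: zero_ereal_def one_ereal_def)
    note * = this
    show ?thesis
    proof (cases c)
      case (real r)
      then have "s * r \<le> s * x" using * 2 by (intro mult_left_mono) auto
      then have "s * r + z \<le> h + k" using * z by linarith
      then show ?thesis using real 2 by simp
    qed (use * 2 in auto)
  next
    case 3
    then obtain x where x: "b = ereal x" using b assms(4) by (cases b) auto
    then have "c \<le> ereal x" "t * x + v \<le> k" "u \<le> h"
      using 3 a b c by (simp_all flip: zero_ereal_def one_ereal_def)
    note * = this
    show ?thesis
    proof (cases c)
      case (real r)
      then have "t * r \<le> t * x" using * 3 by (intro mult_left_mono) auto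
      then have "t * r + z \<le> h + k" using * z by linarith
      then show ?thesis using real 3 by simp
    qed (use * 3 in auto)
  next
    case 4
    then obtain x y where x: "a = ereal x" "b = ereal y" using a b assms(3,4) by (cases a; cases b) auto
    show ?thesis
    proof (cases c)
      case (real r)
      have "s * x + t * y + (u + v) \<le> h + k" using a b x by simp
      moreover have "(s + t) * r \<le> (s + t) * (s / (s + t) * x + (1 - s / (s + t)) * y)"
        using c x real 4 by (intro mult_left_mono) auto
      moreover have "(s + t) * (s / (s + t) * x + (1 - s / (s + t)) * y) = s * x + t * y"
      proof -
        have \<sigma>: "(s + t) * (s / (s + t)) = s" using 4 by simp
        have "(s + t) * (\<sigma> * x + (1 - \<sigma>) * y) = ((s + t) * \<sigma>) * x + ((s + t) - (s + t) * \<sigma>) * y" for \<sigma>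
          by (simp add: algebra_simps)
        from this[of "s / (s + t)"] show ?thesis unfolding \<sigma> by simp
      qed
      ultimately show ?thesis using real z by simp
    qed (use c x 4 in auto)
  qed
qed

text \<open>Positive homogeneity of the same functional. If \<open>t\<close> is positive, the bound
  excludes \<open>a = \<infinity>\<close>; if \<open>t = 0\<close>, the value \<open>a\<close>
  disappears from both sides.\<close>

lemma ereal_perspective_scale:
  fixes a :: ereal and s t u h :: real
  assumes "0 \<le> s" "0 \<le> t" "ereal t * a + ereal u \<le> ereal h"
  shows "ereal (s * t) * a + ereal (s * u) \<le> ereal (s * h)"
proof (cases "t = 0")
  case True
  then show ?thesis using assms by (simp add: mult_left_mono flip: zero_ereal_def)
next
  case False
  show ?thesis
  proof (cases a)
    case (real x)
    then have "s * (t * x + u) \<le> s * h" using assms by (intro mult_left_mono) auto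
    then show ?thesis using real by (simp add: algebra_simps)
  next
    case PInf
    then show ?thesis using assms False by simp
  next
    case MInf
    then show ?thesis using assms False by (cases "s = 0") (auto simp flip: zero_ereal_def)
  qed
qed

text \<open>The weights sum to 1, so a real constant can be distributed over the two terms. The
  endpoints are separate because there an infinite value is multiplied by 0.\<close>

lemma ereal_convex_shift:
  fixes a b c :: ereal and s r :: real
  assumes "0 \<le> s" "s \<le> 1" "-\<infinity> < a" "-\<infinity> < b" "c \<le> ereal s * a + ereal (1 - s) * b"
  shows "c - ereal r \<le> ereal s * (a - ereal r) + ereal (1 - s) * (b - ereal r)"
proof -
  consider "s = 0" | "s = 1" | "0 < s" "s < 1" using assms by linarith
  then show ?thesis
  proof cases
    case 1
    then show ?thesis using assms by (simp add: ereal_minus_mono flip: zero_ereal_def one_ereal_def)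
  next
    case 2
    then show ?thesis using assms by (simp add: ereal_minus_mono flip: zero_ereal_def one_ereal_def)
  next
    case 3
    show ?thesis
    proof (cases "a = \<infinity> \<or> b = \<infinity>")
      case True
      then have *: "ereal s * (a - ereal r) + ereal (1 - s) * (b - ereal r) = \<infinity>"
        using 3 assms(3,4) by (cases a; cases b) auto
      show ?thesis unfolding * by simp
    next
      case False
      then obtain x y where "a = ereal x" "b = ereal y" using assms(3,4) by (cases a; cases b) auto
      then show ?thesis using assms by (cases c) (auto simp: algebra_simps)
    qed
  qed
qed

section \<open>Scalar multiplication by representing functions\<close>

context random_locally_convex_module
begin

text \<open>With functions in place of classes as scalars, identities between scalars are checked
  pointwise; \<open>sc_cong_AE\<close> restores the independence of the representative.\<close>

definition sc :: "('w \<Rightarrow> real) \<Rightarrow> 'e \<Rightarrow> 'e" where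
  "sc \<phi> x = ae_class M \<phi> \<odot>\<^bsub>E\<^esub> x"

lemma sc_closed [simp, intro]:
  "\<phi> \<in> borel_measurable M \<Longrightarrow> x \<in> carrier E \<Longrightarrow> sc \<phi> x \<in> carrier E"
  by (simp add: sc_def L0_def)

lemma sc_add_left:
  assumes "\<phi> \<in> borel_measurable M" "\<psi> \<in> borel_measurable M" "x \<in> carrier E"
  shows "sc (\<lambda>w. \<phi> w + \<psi> w) x = sc \<phi> x \<oplus>\<^bsub>E\<^esub> sc \<psi> x"
  using E.smult_l_distr[of "ae_class M \<phi>" "ae_class M \<psi>" x] assms
  by (simp add: sc_def L0_def ae_map2_class)

lemma sc_add_right:
  assumes "\<phi> \<in> borel_measurable M" "x \<in> carrier E" "y \<in> carrier E"
  shows "sc \<phi> (x \<oplus>\<^bsub>E\<^esub> y) = sc \<phi> x \<oplus>\<^bsub>E\<^esub> sc \<phi> y"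
  using E.smult_r_distr[of "ae_class M \<phi>" x y] assms by (simp add: sc_def L0_def)

lemma sc_sc:
  assumes "\<phi> \<in> borel_measurable M" "\<psi> \<in> borel_measurable M" "x \<in> carrier E"
  shows "sc \<phi> (sc \<psi> x) = sc (\<lambda>w. \<phi> w * \<psi> w) x"
  using E.smult_assoc1[of "ae_class M \<phi>" "ae_class M \<psi>" x] assms
  by (simp add: sc_def L0_def ae_map2_class)

lemma sc_one [simp]: "x \<in> carrier E \<Longrightarrow> sc (\<lambda>_. 1) x = x"
  using E.smult_one[of x] by (simp add: sc_def L0_def)

lemma sc_zero [simp]: "x \<in> carrier E \<Longrightarrow> sc (\<lambda>_. 0) x = \<zero>\<^bsub>E\<^esub>"
  using E.smult_l_null[of x] by (simp add: sc_def L0_def)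

lemma sc_cong_AE:
  assumes "\<phi> \<in> borel_measurable M" "\<psi> \<in> borel_measurable M" "AE w in M. \<phi> w = \<psi> w"
  shows "sc \<phi> x = sc \<psi> x"
  using assms by (metis sc_def ae_class_eq_iff)

lemma sc_split:
  assumes "\<phi> \<in> borel_measurable M" "x \<in> carrier E"
  shows "sc \<phi> x \<oplus>\<^bsub>E\<^esub> sc (\<lambda>w. 1 - \<phi> w) x = x"
  using sc_add_left[of \<phi> "\<lambda>w. 1 - \<phi> w" x] assms by simp

lemma sc_neg_cancel:
  assumes "\<phi> \<in> borel_measurable M" "x \<in> carrier E"
  shows "sc (\<lambda>w. - \<phi> w) x \<oplus>\<^bsub>E\<^esub> sc \<phi> x = \<zero>\<^bsub>E\<^esub>"
  using sc_add_left[of "\<lambda>w. - \<phi> w" \<phi> x] assms by simp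

lemma neg_cancel:
  assumes "x \<in> carrier E"
  shows "sc (\<lambda>_. -1) x \<oplus>\<^bsub>E\<^esub> x = \<zero>\<^bsub>E\<^esub>"
  using sc_neg_cancel[of "\<lambda>_. 1" x] assms by simp

section \<open>A sandwich theorem over \<open>L\<^sup>0\<close>\<close>

text \<open>
  A cone stands for the sublinear functional whose value at \<open>x\<close> is the essential infimum of the
  \<open>h\<close> with \<open>(x, h)\<close> in the cone; a minimal sublinear functional is linear, so Zorn's lemma is
  applied to cones ordered by inclusion, where unions of chains are immediate.
\<close>

definition cones :: "('e \<times> ('w \<Rightarrow> real)) set set" where
  "cones = {C. C \<subseteq> carrier E \<times> borel_measurable M \<and>
     (\<forall>x h y k. (x, h) \<in> C \<longrightarrow> (y, k) \<in> C \<longrightarrow> (x \<oplus>\<^bsub>E\<^esub> y, \<lambda>w. h w + k w) \<in> C) \<and>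
     (\<forall>x h. \<forall>\<phi>\<in>borel_measurable M. (\<forall>w. 0 \<le> \<phi> w) \<longrightarrow> (x, h) \<in> C \<longrightarrow> (sc \<phi> x, \<lambda>w. \<phi> w * h w) \<in> C) \<and>
     (\<forall>x h. \<forall>k\<in>borel_measurable M. (x, h) \<in> C \<longrightarrow> (AE w in M. h w \<le> k w) \<longrightarrow> (x, k) \<in> C) \<and>
     (\<forall>h. (\<zero>\<^bsub>E\<^esub>, h) \<in> C \<longrightarrow> (AE w in M. 0 \<le> h w))}"

lemma conesI:
  assumes "\<And>x h. (x, h) \<in> C \<Longrightarrow> x \<in> carrier E \<and> h \<in> borel_measurable M"
    and "\<And>x h y k. (x, h) \<in> C \<Longrightarrow> (y, k) \<in> C \<Longrightarrow> (x \<oplus>\<^bsub>E\<^esub> y, \<lambda>w. h w + k w) \<in> C"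
    and "\<And>x h \<phi>. \<phi> \<in> borel_measurable M \<Longrightarrow> (\<And>w. 0 \<le> \<phi> w) \<Longrightarrow> (x, h) \<in> C \<Longrightarrow>
      (sc \<phi> x, \<lambda>w. \<phi> w * h w) \<in> C"
    and "\<And>x h k. k \<in> borel_measurable M \<Longrightarrow> (x, h) \<in> C \<Longrightarrow> AE w in M. h w \<le> k w \<Longrightarrow> (x, k) \<in> C"
    and "\<And>h. (\<zero>\<^bsub>E\<^esub>, h) \<in> C \<Longrightarrow> AE w in M. 0 \<le> h w"
  shows "C \<in> cones"
  using assms unfolding cones_def by (intro CollectI conjI) (blast | force)+

lemma conesD:
  assumes "C \<in> cones"
  shows "\<And>x h. (x, h) \<in> C \<Longrightarrow> x \<in> carrier E"
    and "\<And>x h. (x, h) \<in> C \<Longrightarrow> h \<in> borel_measurable M"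
    and "\<And>x h y k. (x, h) \<in> C \<Longrightarrow> (y, k) \<in> C \<Longrightarrow> (x \<oplus>\<^bsub>E\<^esub> y, \<lambda>w. h w + k w) \<in> C"
    and "\<And>x h \<phi>. \<phi> \<in> borel_measurable M \<Longrightarrow> (\<And>w. 0 \<le> \<phi> w) \<Longrightarrow> (x, h) \<in> C \<Longrightarrow>
      (sc \<phi> x, \<lambda>w. \<phi> w * h w) \<in> C"
    and "\<And>x h k. k \<in> borel_measurable M \<Longrightarrow> (x, h) \<in> C \<Longrightarrow> AE w in M. h w \<le> k w \<Longrightarrow> (x, k) \<in> C"
    and "\<And>h. (\<zero>\<^bsub>E\<^esub>, h) \<in> C \<Longrightarrow> AE w in M. 0 \<le> h w"
  using assms unfolding cones_def by blast+

text \<open>Each closure condition on a cone involves at most two of its elements, and two elements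
  of the union of a chain lie in a common member.\<close>

lemma cones_maximal:
  assumes C0: "C0 \<in> cones"
  obtains C where "C \<in> cones" "C0 \<subseteq> C" "\<And>D. D \<in> cones \<Longrightarrow> C \<subseteq> D \<Longrightarrow> D = C"
proof -
  let ?A = "{C \<in> cones. C0 \<subseteq> C}"
  have "\<exists>C\<in>?A. \<forall>D\<in>?A. C \<subseteq> D \<longrightarrow> D = C"
  proof (rule subset_Zorn_nonempty)
    show "?A \<noteq> {}" using C0 by auto
    fix \<C> assume ne: "\<C> \<noteq> {}" and ch: "subset.chain ?A \<C>"
    have sub: "D \<in> cones" "C0 \<subseteq> D" if "D \<in> \<C>" for D
      using ch that by (auto simp: subset.chain_def)
    have tot: "D \<subseteq> D' \<or> D' \<subseteq> D" if "D \<in> \<C>" "D' \<in> \<C>" for D D'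
      using ch that unfolding subset.chain_def by blast
    have "\<Union>\<C> \<in> cones"
    proof (rule conesI)
      fix x h y k assume "(x, h) \<in> \<Union>\<C>" "(y, k) \<in> \<Union>\<C>"
      then obtain D D' where "D \<in> \<C>" "(x, h) \<in> D" "D' \<in> \<C>" "(y, k) \<in> D'" by auto
      moreover from this obtain D'' where "D'' \<in> \<C>" "(x, h) \<in> D''" "(y, k) \<in> D''"
        using tot[of D D'] by blast
      ultimately show "(x \<oplus>\<^bsub>E\<^esub> y, \<lambda>w. h w + k w) \<in> \<Union>\<C>"
        using conesD(3)[OF sub(1)] by blast
    next
      fix x h assume "(x, h) \<in> \<Union>\<C>"
      then show "x \<in> carrier E \<and> h \<in> borel_measurable M" using conesD(1,2)[OF sub(1)] by blast
    next
      fix x h and \<phi> :: "'w \<Rightarrow> real"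
      assume "\<phi> \<in> borel_measurable M" "\<And>w. 0 \<le> \<phi> w" "(x, h) \<in> \<Union>\<C>"
      then show "(sc \<phi> x, \<lambda>w. \<phi> w * h w) \<in> \<Union>\<C>" using conesD(4)[OF sub(1)] by blast
    next
      fix x h k assume "k \<in> borel_measurable M" "(x, h) \<in> \<Union>\<C>" "AE w in M. h w \<le> k w"
      then show "(x, k) \<in> \<Union>\<C>" using conesD(5)[OF sub(1)] by blast
    next
      fix h assume "(\<zero>\<^bsub>E\<^esub>, h) \<in> \<Union>\<C>"
      then show "AE w in M. 0 \<le> h w" using conesD(6)[OF sub(1)] by blast
    qed
    then show "\<Union>\<C> \<in> ?A" using ne sub(2) by auto
  qed
  then show thesis using that by (metis (mono_tags, lifting) mem_Collect_eq order_trans)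
qed

text \<open>The lower bound \<open>a\<close> over \<open>x\<close> scales to \<open>\<phi> x\<close>
  although \<open>\<phi>\<close> may vanish somewhere. On the support of \<open>\<phi>\<close> one
  divides; on the rest the claim is that \<open>k\<close> is nonnegative, which comes from
  comparison with a multiple of \<open>-x\<close>.\<close>

lemma cones_lower_bound:
  assumes C: "C \<in> cones" and a: "a \<in> borel_measurable M"
    and x: "x \<in> carrier E" and tot: "\<And>z. z \<in> carrier E \<Longrightarrow> \<exists>h. (z, h) \<in> C"
    and al: "\<And>h. (x, h) \<in> C \<Longrightarrow> AE w in M. a w \<le> h w"
    and \<phi>: "\<phi> \<in> borel_measurable M" "\<And>w. 0 \<le> \<phi> w" and k: "(sc \<phi> x, k) \<in> C"
  shows "AE w in M. \<phi> w * a w \<le> k w"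
proof -
  note CD = conesD[OF C]
  have [measurable]: "\<phi> \<in> borel_measurable M" "k \<in> borel_measurable M" using \<phi> CD(2)[OF k] by auto
  define I where "I w = (if 0 < \<phi> w then 1 else 0 :: real)" for w
  have [measurable]: "I \<in> borel_measurable M" unfolding I_def by measurable
  obtain h0 where h0: "(x, h0) \<in> C" using tot x by auto
  obtain h1 where h1: "(sc (\<lambda>_. -1) x, h1) \<in> C" using tot[of "sc (\<lambda>_. -1) x"] x by auto
  \<comment> \<open>Where \<open>\<phi>\<close> vanishes, \<open>1 / \<phi> w\<close> is 0, so this
    is only the part of \<open>x\<close> on the support; \<open>h0\<close> supplies a height for the
    remaining part.\<close>
  have "(sc (\<lambda>w. 1 / \<phi> w) (sc \<phi> x), \<lambda>w. 1 / \<phi> w * k w) \<in> C"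
    using \<phi> k by (intro CD(4)) auto
  moreover have "sc (\<lambda>w. 1 / \<phi> w) (sc \<phi> x) = sc I x"
    using x \<phi> by (subst sc_sc) (auto intro!: sc_cong_AE AE_I2 simp: I_def less_le)
  moreover have "(sc (\<lambda>w. 1 - I w) x, \<lambda>w. (1 - I w) * h0 w) \<in> C"
    using h0 by (intro CD(4)) (auto simp: I_def)
  ultimately have "(x, \<lambda>w. 1 / \<phi> w * k w + (1 - I w) * h0 w) \<in> C"
    using CD(3) sc_split[of I x] x by fastforce
  from al[OF this] have 1: "AE w in M. a w \<le> 1 / \<phi> w * k w + (1 - I w) * h0 w" .
  \<comment> \<open>This serves the points with \<open>\<phi> w = 0\<close>, where the height
    \<open>\<phi> w * h1 w\<close> vanishes.\<close>
  have "(sc \<phi> (sc (\<lambda>_. -1) x), \<lambda>w. \<phi> w * h1 w) \<in> C"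
    using \<phi> h1 by (intro CD(4)) auto
  then have "(sc \<phi> x \<oplus>\<^bsub>E\<^esub> sc \<phi> (sc (\<lambda>_. -1) x), \<lambda>w. k w + \<phi> w * h1 w) \<in> C"
    using k by (intro CD(3))
  moreover have "sc \<phi> x \<oplus>\<^bsub>E\<^esub> sc \<phi> (sc (\<lambda>_. -1) x) = \<zero>\<^bsub>E\<^esub>"
    using sc_neg_cancel[of \<phi> x] x by (simp add: sc_sc E.a_comm)
  ultimately have 2: "AE w in M. 0 \<le> k w + \<phi> w * h1 w" using CD(6) by auto
  from 1 2 show ?thesis
  proof eventually_elim
    case (elim w)
    show ?case
    proof (cases "0 < \<phi> w")
      case True
      then show ?thesis using elim(1) by (simp add: I_def field_simps)
    next
      case False
      then have "\<phi> w = 0" using \<phi>(2)[of w] by auto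
      then show ?thesis using elim(2) by simp
    qed
  qed
qed

text \<open>\<open>a x\<close> is the essential infimum of the heights over \<open>x\<close> in a
  maximal cone. Maximality forces the pair of \<open>-x\<close> and \<open>- a x\<close> into the
  cone, so \<open>a\<close> is odd. Superadditivity together with oddness is additivity, and the
  same device turns superhomogeneity into homogeneity.\<close>

lemma Hahn_Banach_cone:
  assumes C0: "C0 \<in> cones" and tot0: "\<And>z. z \<in> carrier E \<Longrightarrow> \<exists>h. (z, h) \<in> C0"
  obtains a where "\<And>x. x \<in> carrier E \<Longrightarrow> a x \<in> borel_measurable M"
    "\<And>x h. (x, h) \<in> C0 \<Longrightarrow> AE w in M. a x w \<le> h w"
    "\<And>x y. x \<in> carrier E \<Longrightarrow> y \<in> carrier E \<Longrightarrow> AE w in M. a (x \<oplus>\<^bsub>E\<^esub> y) w = a x w + a y w"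
    "\<And>\<phi> x. \<phi> \<in> borel_measurable M \<Longrightarrow> x \<in> carrier E \<Longrightarrow> AE w in M. a (sc \<phi> x) w = \<phi> w * a x w"
proof -
  obtain C where C: "C \<in> cones" "C0 \<subseteq> C" "\<And>D. D \<in> cones \<Longrightarrow> C \<subseteq> D \<Longrightarrow> D = C"
    using cones_maximal[OF C0] by metis
  note CD = conesD[OF C(1)]
  let ?n = "sc (\<lambda>_. -1)"
  have tot: "\<exists>h. (z, h) \<in> C" if "z \<in> carrier E" for z using tot0[OF that] C(2) by auto
  have z0: "(\<zero>\<^bsub>E\<^esub>, \<lambda>_. 0) \<in> C"
    using CD(4)[of "\<lambda>_. 0"] tot[OF E.zero_closed] by fastforce
  \<comment> \<open>A height over \<open>-x\<close> bounds all heights over \<open>x\<close> from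
    below, which keeps the essential infimum real-valued.\<close>
  have sum0: "AE w in M. - k w \<le> h w" if "(x, h) \<in> C" "(?n x, k) \<in> C" for x h k
  proof -
    have "x \<in> carrier E" using CD(1) that by auto
    then have "?n x \<oplus>\<^bsub>E\<^esub> x = \<zero>\<^bsub>E\<^esub>" by (rule neg_cancel)
    then have "(\<zero>\<^bsub>E\<^esub>, \<lambda>w. k w + h w) \<in> C" using CD(3)[OF that(2,1)] by simp
    from CD(6)[OF this] show ?thesis by eventually_elim simp
  qed
  have "\<exists>a. a \<in> borel_measurable M \<and> (\<forall>h. (x, h) \<in> C \<longrightarrow> (AE w in M. a w \<le> h w)) \<and>
      (\<forall>b. b \<in> borel_measurable M \<longrightarrow> (\<forall>h. (x, h) \<in> C \<longrightarrow> (AE w in M. b w \<le> h w)) \<longrightarrow>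
        (AE w in M. b w \<le> a w))"
    if x: "x \<in> carrier E" for x
  proof -
    obtain k where k: "(?n x, k) \<in> C" using tot[of "?n x"] x by auto
    have "{h. (x, h) \<in> C} \<subseteq> borel_measurable M" "{h. (x, h) \<in> C} \<noteq> {}"
      using CD(2) tot[OF x] by auto
    moreover have "(\<lambda>w. - k w) \<in> borel_measurable M" using CD(2)[OF k] by measurable
    ultimately obtain a where "a \<in> borel_measurable M"
      "\<And>h. h \<in> {h. (x, h) \<in> C} \<Longrightarrow> AE w in M. a w \<le> h w"
      "\<And>b. b \<in> borel_measurable M \<Longrightarrow> (\<And>h. h \<in> {h. (x, h) \<in> C} \<Longrightarrow> AE w in M. b w \<le> h w) \<Longrightarrow>
        AE w in M. b w \<le> a w"
      by (rule ex_essential_Inf) (use sum0 k in auto)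
    then show ?thesis by (intro exI[of _ a]) auto
  qed
  then have "\<forall>x\<in>carrier E. \<exists>a. a \<in> borel_measurable M \<and> (\<forall>h. (x, h) \<in> C \<longrightarrow> (AE w in M. a w \<le> h w)) \<and>
      (\<forall>b. b \<in> borel_measurable M \<longrightarrow> (\<forall>h. (x, h) \<in> C \<longrightarrow> (AE w in M. b w \<le> h w)) \<longrightarrow>
        (AE w in M. b w \<le> a w))"
    by blast
  then obtain a where a: "\<forall>x\<in>carrier E. a x \<in> borel_measurable M \<and>
      (\<forall>h. (x, h) \<in> C \<longrightarrow> (AE w in M. a x w \<le> h w)) \<and>
      (\<forall>b. b \<in> borel_measurable M \<longrightarrow> (\<forall>h. (x, h) \<in> C \<longrightarrow> (AE w in M. b w \<le> h w)) \<longrightarrow>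
        (AE w in M. b w \<le> a x w))"
    by (rule bchoice[THEN exE])
  have am: "a x \<in> borel_measurable M" if "x \<in> carrier E" for x using a that by blast
  have al: "AE w in M. a x w \<le> h w" if "x \<in> carrier E" "(x, h) \<in> C" for x h using a that by blast
  have ag: "AE w in M. b w \<le> a x w" if "x \<in> carrier E" "b \<in> borel_measurable M"
    "\<And>h. (x, h) \<in> C \<Longrightarrow> AE w in M. b w \<le> h w" for x b using a that by blast
  note am [measurable]
  have neg: "(?n x, \<lambda>w. - a x w) \<in> C" if x: "x \<in> carrier E" for x
  proof -
    \<comment> \<open>adjoining the ray through \<open>(-x, -a x)\<close>\<close>
    define D where "D = {(z, h). z \<in> carrier E \<and> h \<in> borel_measurable M \<and>
      (\<exists>\<phi>\<in>borel_measurable M. (\<forall>w. 0 \<le> \<phi> w) \<and> (z \<oplus>\<^bsub>E\<^esub> sc \<phi> x, \<lambda>w. h w + \<phi> w * a x w) \<in> C)}"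
    have "D \<in> cones"
    proof (rule conesI)
      fix y h z k assume "(y, h) \<in> D" "(z, k) \<in> D"
      then obtain \<phi> \<psi> where yz: "y \<in> carrier E" "h \<in> borel_measurable M" "z \<in> carrier E" "k \<in> borel_measurable M"
        and m: "\<phi> \<in> borel_measurable M" "\<And>w. 0 \<le> \<phi> w" "\<psi> \<in> borel_measurable M" "\<And>w. 0 \<le> \<psi> w"
        and c: "(y \<oplus>\<^bsub>E\<^esub> sc \<phi> x, \<lambda>w. h w + \<phi> w * a x w) \<in> C" "(z \<oplus>\<^bsub>E\<^esub> sc \<psi> x, \<lambda>w. k w + \<psi> w * a x w) \<in> C"
        unfolding D_def by auto
      have "(y \<oplus>\<^bsub>E\<^esub> sc \<phi> x) \<oplus>\<^bsub>E\<^esub> (z \<oplus>\<^bsub>E\<^esub> sc \<psi> x) = (y \<oplus>\<^bsub>E\<^esub> z) \<oplus>\<^bsub>E\<^esub> sc (\<lambda>w. \<phi> w + \<psi> w) x"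
        using yz m x by (simp add: sc_add_left E.a_ac)
      with CD(3)[OF c] have "((y \<oplus>\<^bsub>E\<^esub> z) \<oplus>\<^bsub>E\<^esub> sc (\<lambda>w. \<phi> w + \<psi> w) x,
          \<lambda>w. (h w + k w) + (\<phi> w + \<psi> w) * a x w) \<in> C"
        by (simp add: algebra_simps)
      then show "(y \<oplus>\<^bsub>E\<^esub> z, \<lambda>w. h w + k w) \<in> D"
        unfolding D_def using yz m by (auto intro!: bexI[of _ "\<lambda>w. \<phi> w + \<psi> w"])
    next
      fix y h and \<psi> :: "'w \<Rightarrow> real"
      assume \<psi>: "\<psi> \<in> borel_measurable M" "\<And>w. 0 \<le> \<psi> w" and "(y, h) \<in> D"
      then obtain \<phi> where yz: "y \<in> carrier E" "h \<in> borel_measurable M"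
        and m: "\<phi> \<in> borel_measurable M" "\<And>w. 0 \<le> \<phi> w"
        and c: "(y \<oplus>\<^bsub>E\<^esub> sc \<phi> x, \<lambda>w. h w + \<phi> w * a x w) \<in> C"
        unfolding D_def by auto
      have "sc \<psi> (y \<oplus>\<^bsub>E\<^esub> sc \<phi> x) = sc \<psi> y \<oplus>\<^bsub>E\<^esub> sc (\<lambda>w. \<psi> w * \<phi> w) x"
        using yz m x \<psi> by (simp add: sc_add_right sc_sc)
      with CD(4)[OF \<psi> c] have "(sc \<psi> y \<oplus>\<^bsub>E\<^esub> sc (\<lambda>w. \<psi> w * \<phi> w) x,
          \<lambda>w. \<psi> w * h w + (\<psi> w * \<phi> w) * a x w) \<in> C"
        by (simp add: algebra_simps)
      then show "(sc \<psi> y, \<lambda>w. \<psi> w * h w) \<in> D"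
        unfolding D_def using yz m \<psi> by (auto intro!: bexI[of _ "\<lambda>w. \<psi> w * \<phi> w"])
    next
      fix y h k assume k: "k \<in> borel_measurable M" "AE w in M. h w \<le> k w" and "(y, h) \<in> D"
      then obtain \<phi> where yz: "y \<in> carrier E" "h \<in> borel_measurable M"
        and m: "\<phi> \<in> borel_measurable M" "\<And>w. 0 \<le> \<phi> w"
        and c: "(y \<oplus>\<^bsub>E\<^esub> sc \<phi> x, \<lambda>w. h w + \<phi> w * a x w) \<in> C"
        unfolding D_def by auto
      have "(y \<oplus>\<^bsub>E\<^esub> sc \<phi> x, \<lambda>w. k w + \<phi> w * a x w) \<in> C"
        using k m x by (intro CD(5)[OF _ c]) auto
      then show "(y, k) \<in> D" unfolding D_def using yz m k by auto
    next
      fix h assume "(\<zero>\<^bsub>E\<^esub>, h) \<in> D"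
      then obtain \<phi> where m: "\<phi> \<in> borel_measurable M" "\<And>w. 0 \<le> \<phi> w"
        and c: "(sc \<phi> x, \<lambda>w. h w + \<phi> w * a x w) \<in> C"
        unfolding D_def using x by auto
      \<comment> \<open>The only condition on the enlarged cone that depends on the choice of
        \<open>a x\<close>: lowering the height over \<open>-x\<close> to \<open>- a x\<close>
        creates no negative height over zero.\<close>
      have "AE w in M. \<phi> w * a x w \<le> h w + \<phi> w * a x w"
        by (rule cones_lower_bound[OF C(1) am[OF x] x tot al[OF x] m c])
      then show "AE w in M. 0 \<le> h w" by eventually_elim simp
    qed (auto simp: D_def)
    moreover have "C \<subseteq> D"
    proof
      fix p assume "p \<in> C"
      then show "p \<in> D" using CD(1,2) x by (cases p) (auto simp: D_def intro!: bexI[of _ "\<lambda>_. 0"])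
    qed
    ultimately have "D = C" by (rule C(3))
    moreover have "(?n x, \<lambda>w. - a x w) \<in> D"
      using x z0 am[OF x] neg_cancel[OF x] by (auto simp: D_def intro!: bexI[of _ "\<lambda>_. 1"])
    ultimately show ?thesis by simp
  qed
  have nn: "?n (?n x) = x" if "x \<in> carrier E" for x using that by (simp add: sc_sc)
  have pos: "(x, \<lambda>w. - a (?n x) w) \<in> C" if x: "x \<in> carrier E" for x
    using neg[of "?n x"] nn[OF x] x by simp
  have odd: "AE w in M. a (?n x) w = - a x w" if x: "x \<in> carrier E" for x
  proof -
    have nx: "?n x \<in> carrier E" using x by simp
    have "AE w in M. - a x w \<le> a (?n x) w"
    proof (rule ag[OF nx])
      fix h assume h: "(?n x, h) \<in> C"
      have "AE w in M. - h w \<le> a x w"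
        by (rule ag[OF x]) (use CD(2)[OF h] sum0 h in auto)
      then show "AE w in M. - a x w \<le> h w" by eventually_elim simp
    qed (use am[OF x] in measurable)
    then show ?thesis using al[OF nx neg[OF x]] by eventually_elim simp
  qed
  have super: "AE w in M. a x w + a y w \<le> a (x \<oplus>\<^bsub>E\<^esub> y) w"
    if xy: "x \<in> carrier E" "y \<in> carrier E" for x y
  proof (rule ag)
    have "(?n (x \<oplus>\<^bsub>E\<^esub> y), \<lambda>w. - a x w + - a y w) \<in> C"
      using CD(3)[OF neg[OF xy(1)] neg[OF xy(2)]] xy by (simp add: sc_add_right)
    from sum0[OF _ this] show "AE w in M. a x w + a y w \<le> h w"
      if "(x \<oplus>\<^bsub>E\<^esub> y, h) \<in> C" for h
      using that by simp (simp add: algebra_simps)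
  qed (use xy am in auto)
  have add: "AE w in M. a (x \<oplus>\<^bsub>E\<^esub> y) w = a x w + a y w"
    if xy: "x \<in> carrier E" "y \<in> carrier E" for x y
  proof -
    \<comment> \<open>Superadditivity at \<open>-x\<close> and \<open>-y\<close> is, by oddness,
      subadditivity at \<open>x\<close> and \<open>y\<close>.\<close>
    have "AE w in M. a (?n x) w + a (?n y) w \<le> a (?n (x \<oplus>\<^bsub>E\<^esub> y)) w"
      using super[of "?n x" "?n y"] xy by (simp add: sc_add_right)
    then show ?thesis
      using odd[OF xy(1)] odd[OF xy(2)] odd[OF E.a_closed[OF xy]] super[OF xy]
      by eventually_elim simp
  qed
  have hom_super: "AE w in M. \<phi> w * a x w \<le> a (sc \<phi> x) w"
    if x: "x \<in> carrier E" and p: "\<phi> \<in> borel_measurable M" "\<And>w. 0 \<le> \<phi> w" for x \<phi>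
  proof (rule ag)
    have "(sc \<phi> (?n x), \<lambda>w. \<phi> w * - a x w) \<in> C" using p by (intro CD(4) neg x) auto
    moreover have "sc \<phi> (?n x) = ?n (sc \<phi> x)" using p x by (simp add: sc_sc)
    ultimately have "(?n (sc \<phi> x), \<lambda>w. \<phi> w * - a x w) \<in> C" by simp
    from sum0[OF _ this] show "AE w in M. \<phi> w * a x w \<le> h w" if "(sc \<phi> x, h) \<in> C" for h
      using that by simp
  qed (use x p am in auto)
  have hom: "AE w in M. a (sc \<phi> x) w = \<phi> w * a x w"
    if x: "x \<in> carrier E" and p: "\<phi> \<in> borel_measurable M" "\<And>w. 0 \<le> \<phi> w" for x \<phi>
  proof -
    have "sc \<phi> (?n x) = ?n (sc \<phi> x)" using p x by (simp add: sc_sc)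
    then have "AE w in M. \<phi> w * a (?n x) w \<le> a (?n (sc \<phi> x)) w"
      using hom_super[of "?n x" \<phi>] x p by simp
    moreover have "AE w in M. a (?n (sc \<phi> x)) w = - a (sc \<phi> x) w" using x p by (intro odd) auto
    ultimately show ?thesis using odd[OF x] hom_super[OF x p]
      by eventually_elim simp
  qed
  show thesis
  proof (rule that[of a])
    fix x h assume "(x, h) \<in> C0"
    then show "AE w in M. a x w \<le> h w" using C(2) al CD(1) by blast
  next
    fix x y assume "x \<in> carrier E" "y \<in> carrier E"
    then show "AE w in M. a (x \<oplus>\<^bsub>E\<^esub> y) w = a x w + a y w" by (rule add)
  next
    fix \<phi> :: "'w \<Rightarrow> real" and x assume p: "\<phi> \<in> borel_measurable M" and x: "x \<in> carrier E"
    let ?p = "\<lambda>w. max 0 (\<phi> w)" and ?m = "\<lambda>w. max 0 (- \<phi> w)"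
    \<comment> \<open>A scalar of varying sign is split into its positive and negative parts, the
      latter acting on \<open>-x\<close>, so that only nonnegative scalars remain.\<close>
    have "sc \<phi> x = sc (\<lambda>w. ?p w + (?m w * -1)) x"
      by (rule arg_cong[of _ _ "\<lambda>\<phi>. sc \<phi> x"]) (auto simp: max_def)
    also have "\<dots> = sc ?p x \<oplus>\<^bsub>E\<^esub> sc ?m (?n x)"
      using p x by (subst sc_add_left) (auto simp: sc_sc)
    finally have "AE w in M. a (sc \<phi> x) w = a (sc ?p x) w + a (sc ?m (?n x)) w"
      using add[of "sc ?p x" "sc ?m (?n x)"] p x by simp
    moreover have "AE w in M. a (sc ?p x) w = ?p w * a x w"
      using p x by (intro hom) auto
    moreover have "AE w in M. a (sc ?m (?n x)) w = ?m w * a (?n x) w"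
      using p x by (intro hom) auto
    ultimately show "AE w in M. a (sc \<phi> x) w = \<phi> w * a x w"
      using odd[OF x] by eventually_elim (auto simp: max_def)
  qed (use am in auto)
qed

text \<open>The infimum over \<open>\<phi>\<close> and \<open>y\<close> of \<phi> F(y) + p(z -
  \<phi> y) is sublinear in z. The choice \<open>\<phi> = 0\<close> puts it below \<open>p\<close>,
  the choice \<open>\<phi> = 1\<close> below \<open>F\<close>. Since \<open>F\<close> lies above
  \<open>-p\<close> and \<open>p\<close> is even, its heights over zero are nonnegative, so a linear
  functional below it exists.\<close>

lemma sandwich:
  fixes F :: "'e \<Rightarrow> 'w \<Rightarrow> ereal" and p :: "'e \<Rightarrow> 'w \<Rightarrow> real"
  assumes pm: "\<And>x. x \<in> carrier E \<Longrightarrow> p x \<in> borel_measurable M"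
    and pa: "\<And>x y. x \<in> carrier E \<Longrightarrow> y \<in> carrier E \<Longrightarrow> AE w in M. p (x \<oplus>\<^bsub>E\<^esub> y) w \<le> p x w + p y w"
    and ph: "\<And>\<phi> x. \<phi> \<in> borel_measurable M \<Longrightarrow> x \<in> carrier E \<Longrightarrow> AE w in M. p (sc \<phi> x) w = \<bar>\<phi> w\<bar> * p x w"
    and Fp: "\<And>x. x \<in> carrier E \<Longrightarrow> AE w in M. ereal (- p x w) \<le> F x w"
    and Fc: "\<And>\<phi> x y. \<phi> \<in> borel_measurable M \<Longrightarrow> (\<And>w. 0 \<le> \<phi> w \<and> \<phi> w \<le> 1) \<Longrightarrow>
      x \<in> carrier E \<Longrightarrow> y \<in> carrier E \<Longrightarrow>
      AE w in M. F (sc \<phi> x \<oplus>\<^bsub>E\<^esub> sc (\<lambda>w. 1 - \<phi> w) y) w \<le> ereal (\<phi> w) * F x w + ereal (1 - \<phi> w) * F y w"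
    and Fm: "\<And>x. x \<in> carrier E \<Longrightarrow> F x \<in> borel_measurable M"
  obtains a where "\<And>x. x \<in> carrier E \<Longrightarrow> a x \<in> borel_measurable M"
    "\<And>x. x \<in> carrier E \<Longrightarrow> AE w in M. ereal (a x w) \<le> F x w"
    "\<And>x. x \<in> carrier E \<Longrightarrow> AE w in M. a x w \<le> p x w"
    "\<And>x y. x \<in> carrier E \<Longrightarrow> y \<in> carrier E \<Longrightarrow> AE w in M. a (x \<oplus>\<^bsub>E\<^esub> y) w = a x w + a y w"
    "\<And>\<phi> x. \<phi> \<in> borel_measurable M \<Longrightarrow> x \<in> carrier E \<Longrightarrow> AE w in M. a (sc \<phi> x) w = \<phi> w * a x w"
proof -
  have p0: "AE w in M. p \<zero>\<^bsub>E\<^esub> w = 0" using ph[of "\<lambda>_. 0" "\<zero>\<^bsub>E\<^esub>"] by simp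
  \<comment> \<open>the epigraph of \<open>z \<mapsto> inf {\<phi> F(y) + p(z - \<phi> y)}\<close>\<close>
  define C0 where "C0 = {(z, h). z \<in> carrier E \<and> h \<in> borel_measurable M \<and>
    (\<exists>y\<in>carrier E. \<exists>\<phi>\<in>borel_measurable M. (\<forall>w. 0 \<le> \<phi> w) \<and>
      (AE w in M. ereal (\<phi> w) * F y w + ereal (p (z \<oplus>\<^bsub>E\<^esub> sc (\<lambda>w. - \<phi> w) y) w) \<le> ereal (h w)))}"
  have C0I: "(z, h) \<in> C0" if "z \<in> carrier E" "h \<in> borel_measurable M" "y \<in> carrier E"
    "\<phi> \<in> borel_measurable M" "\<And>w. 0 \<le> \<phi> w"
    "AE w in M. ereal (\<phi> w) * F y w + ereal (p (z \<oplus>\<^bsub>E\<^esub> sc (\<lambda>w. - \<phi> w) y) w) \<le> ereal (h w)" for z h y \<phi>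
    unfolding C0_def using that by auto
  have C0E: "\<exists>y \<phi>. z \<in> carrier E \<and> h \<in> borel_measurable M \<and> y \<in> carrier E \<and>
    \<phi> \<in> borel_measurable M \<and> (\<forall>w. 0 \<le> \<phi> w) \<and>
    (AE w in M. ereal (\<phi> w) * F y w + ereal (p (z \<oplus>\<^bsub>E\<^esub> sc (\<lambda>w. - \<phi> w) y) w) \<le> ereal (h w))"
    if "(z, h) \<in> C0" for z h
    using that unfolding C0_def by auto
  have "C0 \<in> cones"
  proof (rule conesI)
    fix z1 h1 z2 h2 assume "(z1, h1) \<in> C0" "(z2, h2) \<in> C0"
    then obtain y1 \<phi>1 y2 \<phi>2 where
      z: "z1 \<in> carrier E" "z2 \<in> carrier E" "y1 \<in> carrier E" "y2 \<in> carrier E" and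
      m: "h1 \<in> borel_measurable M" "h2 \<in> borel_measurable M" "\<phi>1 \<in> borel_measurable M" "\<phi>2 \<in> borel_measurable M" and
      nn: "\<And>w. 0 \<le> \<phi>1 w" "\<And>w. 0 \<le> \<phi>2 w" and
      ae: "AE w in M. ereal (\<phi>1 w) * F y1 w + ereal (p (z1 \<oplus>\<^bsub>E\<^esub> sc (\<lambda>w. - \<phi>1 w) y1) w) \<le> ereal (h1 w)"
        "AE w in M. ereal (\<phi>2 w) * F y2 w + ereal (p (z2 \<oplus>\<^bsub>E\<^esub> sc (\<lambda>w. - \<phi>2 w) y2) w) \<le> ereal (h2 w)"
      using C0E[of z1 h1] C0E[of z2 h2] by auto
    note [measurable] = m
    \<comment> \<open>The weight that expresses \<open>\<phi>1 y1 + \<phi>2 y2\<close> as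
      \<open>\<phi>1 + \<phi>2\<close> times a convex combination. Where both scalars vanish it is
      0, and both product identities still hold.\<close>
    define \<xi> where "\<xi> w = \<phi>1 w / (\<phi>1 w + \<phi>2 w)" for w
    have \<xi>m [measurable]: "\<xi> \<in> borel_measurable M" unfolding \<xi>_def by measurable
    have \<xi>: "0 \<le> \<xi> w \<and> \<xi> w \<le> 1" for w using nn[of w] by (auto simp: \<xi>_def divide_simps)
    let ?y = "sc \<xi> y1 \<oplus>\<^bsub>E\<^esub> sc (\<lambda>w. 1 - \<xi> w) y2"
    let ?\<phi> = "\<lambda>w. \<phi>1 w + \<phi>2 w"
    have e1: "?\<phi> w * \<xi> w = \<phi>1 w" for w
      using nn[of w] by (cases "?\<phi> w = 0") (simp_all add: \<xi>_def add_nonneg_eq_0_iff)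
    moreover have "?\<phi> w * (1 - \<xi> w) = \<phi>2 w" for w
      using e1[of w] by (simp add: right_diff_distrib)
    ultimately have e: "?\<phi> w * \<xi> w = \<phi>1 w" "?\<phi> w * (1 - \<xi> w) = \<phi>2 w" for w by auto
    have "sc (\<lambda>w. - ?\<phi> w) ?y = sc (\<lambda>w. - ?\<phi> w * \<xi> w) y1 \<oplus>\<^bsub>E\<^esub> sc (\<lambda>w. - ?\<phi> w * (1 - \<xi> w)) y2"
      using z by (subst sc_add_right) (auto simp: sc_sc)
    also have "\<dots> = sc (\<lambda>w. - \<phi>1 w) y1 \<oplus>\<^bsub>E\<^esub> sc (\<lambda>w. - \<phi>2 w) y2"
      unfolding mult_minus_left e ..
    finally have "z1 \<oplus>\<^bsub>E\<^esub> z2 \<oplus>\<^bsub>E\<^esub> sc (\<lambda>w. - ?\<phi> w) ?y =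
        (z1 \<oplus>\<^bsub>E\<^esub> sc (\<lambda>w. - \<phi>1 w) y1) \<oplus>\<^bsub>E\<^esub> (z2 \<oplus>\<^bsub>E\<^esub> sc (\<lambda>w. - \<phi>2 w) y2)"
      using z by (simp add: E.a_ac)
    then have "AE w in M. p (z1 \<oplus>\<^bsub>E\<^esub> z2 \<oplus>\<^bsub>E\<^esub> sc (\<lambda>w. - ?\<phi> w) ?y) w \<le>
        p (z1 \<oplus>\<^bsub>E\<^esub> sc (\<lambda>w. - \<phi>1 w) y1) w + p (z2 \<oplus>\<^bsub>E\<^esub> sc (\<lambda>w. - \<phi>2 w) y2) w"
      using z pa by simp
    with ae Fp[OF z(3)] Fp[OF z(4)] Fc[OF \<xi>m \<xi> z(3,4)]
    have "AE w in M. ereal (?\<phi> w) * F ?y w + ereal (p (z1 \<oplus>\<^bsub>E\<^esub> z2 \<oplus>\<^bsub>E\<^esub> sc (\<lambda>w. - ?\<phi> w) ?y) w) \<le>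
        ereal (h1 w + h2 w)"
    proof eventually_elim
      case (elim w)
      have "-\<infinity> < F y1 w" "-\<infinity> < F y2 w" using elim(3,4) by (auto intro: less_le_trans[rotated])
      then show ?case
        using elim(5) unfolding \<xi>_def
        by (intro ereal_perspective_add[OF nn(1) nn(2) _ _ _ elim(1,2) elim(6)[unfolded \<xi>_def]])
    qed
    then show "(z1 \<oplus>\<^bsub>E\<^esub> z2, \<lambda>w. h1 w + h2 w) \<in> C0"
      by (rule C0I[rotated 5]) (use z nn in \<open>auto simp: add_nonneg_nonneg\<close>)
  next
    fix z h and \<psi> :: "'w \<Rightarrow> real"
    assume \<psi>: "\<psi> \<in> borel_measurable M" "\<And>w. 0 \<le> \<psi> w" and "(z, h) \<in> C0"
    then obtain y \<phi> where z: "z \<in> carrier E" "y \<in> carrier E" and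
      m: "h \<in> borel_measurable M" "\<phi> \<in> borel_measurable M" and nn: "\<And>w. 0 \<le> \<phi> w" and
      ae: "AE w in M. ereal (\<phi> w) * F y w + ereal (p (z \<oplus>\<^bsub>E\<^esub> sc (\<lambda>w. - \<phi> w) y) w) \<le> ereal (h w)"
      using C0E[of z h] by auto
    note [measurable] = m \<psi>(1)
    have "sc \<psi> (z \<oplus>\<^bsub>E\<^esub> sc (\<lambda>w. - \<phi> w) y) = sc \<psi> z \<oplus>\<^bsub>E\<^esub> sc (\<lambda>w. - (\<psi> w * \<phi> w)) y"
      using z by (simp add: sc_add_right sc_sc)
    then have "AE w in M. p (sc \<psi> z \<oplus>\<^bsub>E\<^esub> sc (\<lambda>w. - (\<psi> w * \<phi> w)) y) w =
        \<psi> w * p (z \<oplus>\<^bsub>E\<^esub> sc (\<lambda>w. - \<phi> w) y) w"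
      using ph[of \<psi> "z \<oplus>\<^bsub>E\<^esub> sc (\<lambda>w. - \<phi> w) y"] z \<psi>(2) by simp
    with ae have "AE w in M. ereal (\<psi> w * \<phi> w) * F y w +
        ereal (p (sc \<psi> z \<oplus>\<^bsub>E\<^esub> sc (\<lambda>w. - (\<psi> w * \<phi> w)) y) w) \<le> ereal (\<psi> w * h w)"
    proof eventually_elim
      case (elim w)
      show ?case
        using ereal_perspective_scale[OF \<psi>(2) nn elim(1)] elim(2) by simp
    qed
    then show "(sc \<psi> z, \<lambda>w. \<psi> w * h w) \<in> C0"
      by (rule C0I[rotated 5]) (use z nn \<psi>(2) in auto)
  next
    fix z h k assume k: "k \<in> borel_measurable M" "AE w in M. h w \<le> k w" and "(z, h) \<in> C0"
    then obtain y \<phi> where z: "z \<in> carrier E" "y \<in> carrier E" and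
      m: "h \<in> borel_measurable M" "\<phi> \<in> borel_measurable M" and nn: "\<And>w. 0 \<le> \<phi> w" and
      ae: "AE w in M. ereal (\<phi> w) * F y w + ereal (p (z \<oplus>\<^bsub>E\<^esub> sc (\<lambda>w. - \<phi> w) y) w) \<le> ereal (h w)"
      using C0E[of z h] by auto
    have "AE w in M. ereal (\<phi> w) * F y w + ereal (p (z \<oplus>\<^bsub>E\<^esub> sc (\<lambda>w. - \<phi> w) y) w) \<le> ereal (k w)"
      using ae k(2) by eventually_elim (metis ereal_less_eq(3) order_trans)
    then show "(z, k) \<in> C0" by (rule C0I[rotated 5]) (use z m nn k in auto)
  next
    fix h assume "(\<zero>\<^bsub>E\<^esub>, h) \<in> C0"
    then obtain y \<phi> where z: "y \<in> carrier E" and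
      m: "h \<in> borel_measurable M" "\<phi> \<in> borel_measurable M" and nn: "\<And>w. 0 \<le> \<phi> w" and
      ae: "AE w in M. ereal (\<phi> w) * F y w + ereal (p (\<zero>\<^bsub>E\<^esub> \<oplus>\<^bsub>E\<^esub> sc (\<lambda>w. - \<phi> w) y) w) \<le> ereal (h w)"
      using C0E[of "\<zero>\<^bsub>E\<^esub>" h] by auto
    have "AE w in M. p (sc (\<lambda>w. - \<phi> w) y) w = \<phi> w * p y w"
      using ph[of "\<lambda>w. - \<phi> w" y] z m nn by simp
    with ae Fp[OF z] show "AE w in M. 0 \<le> h w"
    proof eventually_elim
      case (elim w)
      have "ereal (\<phi> w) * ereal (- p y w) \<le> ereal (\<phi> w) * F y w"
        using elim(2) nn by (intro ereal_mult_left_mono) auto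
      then have "ereal (\<phi> w) * ereal (- p y w) + ereal (\<phi> w * p y w) \<le> ereal (\<phi> w) * F y w + ereal (\<phi> w * p y w)"
        by (rule add_right_mono)
      also have "\<dots> \<le> ereal (h w)" using elim(1,3) z m by simp
      finally have "ereal (\<phi> w) * ereal (- p y w) + ereal (\<phi> w * p y w) \<le> ereal (h w)" .
      then show ?case by simp
    qed
  qed (auto simp: C0_def)
  note cone = this
  have C0p: "(z, p z) \<in> C0" if z: "z \<in> carrier E" for z
    \<comment> \<open>With \<open>\<phi> = 0\<close> the term \<open>0 * F y w\<close> is 0 even
      where \<open>F y w\<close> is infinite.\<close>
    by (rule C0I[of _ _ "\<zero>\<^bsub>E\<^esub>" "\<lambda>_. 0"]) (use z pm in \<open>auto simp flip: zero_ereal_def\<close>)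
  have total: "\<exists>h. (z, h) \<in> C0" if "z \<in> carrier E" for z using C0p[OF that] by blast
  show thesis
  proof (rule Hahn_Banach_cone[OF cone total])
    fix a assume am: "\<And>x. x \<in> carrier E \<Longrightarrow> a x \<in> borel_measurable M"
      and al: "\<And>x h. (x, h) \<in> C0 \<Longrightarrow> AE w in M. a x w \<le> h w"
      and lin: "\<And>x y. x \<in> carrier E \<Longrightarrow> y \<in> carrier E \<Longrightarrow> AE w in M. a (x \<oplus>\<^bsub>E\<^esub> y) w = a x w + a y w"
        "\<And>\<phi> x. \<phi> \<in> borel_measurable M \<Longrightarrow> x \<in> carrier E \<Longrightarrow> AE w in M. a (sc \<phi> x) w = \<phi> w * a x w"
    show thesis
    proof (rule that[of a])
      fix x assume x: "x \<in> carrier E"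
      \<comment> \<open>Heights are real, so \<open>F x\<close> itself need not be one. Switching
        the scalar off where \<open>F x\<close> is infinite replaces it there by \<open>p x\<close>,
        and at those points the inequality to be shown is trivial.\<close>
      define I where "I w = (if F x w < \<infinity> then 1 else 0 :: real)" for w
      have Im [measurable]: "I \<in> borel_measurable M"
        using Fm[OF x] unfolding I_def by measurable
      define h where "h w = real_of_ereal (ereal (I w) * F x w) + p (x \<oplus>\<^bsub>E\<^esub> sc (\<lambda>w. - I w) x) w" for w
      have hm: "h \<in> borel_measurable M"
        unfolding h_def using Fm[OF x] pm[of "x \<oplus>\<^bsub>E\<^esub> sc (\<lambda>w. - I w) x"] x by simp
      have "AE w in M. ereal (I w) * F x w + ereal (p (x \<oplus>\<^bsub>E\<^esub> sc (\<lambda>w. - I w) x) w) \<le> ereal (h w)"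
        using Fp[OF x]
      proof eventually_elim
        case (elim w)
        then show ?case by (cases "F x w") (auto simp: h_def I_def zero_ereal_def)
      qed
      then have "(x, h) \<in> C0"
        by (rule C0I[OF x hm x Im, rotated]) (simp add: I_def)
      then have "AE w in M. a x w \<le> h w" by (rule al)
      moreover have "x \<oplus>\<^bsub>E\<^esub> sc (\<lambda>w. - I w) x = sc (\<lambda>w. 1 - I w) x"
        using sc_add_left[of "\<lambda>_. 1" "\<lambda>w. - I w" x] x by simp
      then have "AE w in M. p (x \<oplus>\<^bsub>E\<^esub> sc (\<lambda>w. - I w) x) w = \<bar>1 - I w\<bar> * p x w"
        using ph[of "\<lambda>w. 1 - I w" x] x by simp
      ultimately show "AE w in M. ereal (a x w) \<le> F x w"
        using Fp[OF x]
      proof eventually_elim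
        case (elim w)
        then show ?case by (cases "F x w") (auto simp: h_def I_def)
      qed
    next
      fix x assume "x \<in> carrier E"
      from al[OF C0p[OF this]] show "AE w in M. a x w \<le> p x w" .
    qed (use am lin in auto)
  qed
qed

section \<open>Finite sums of seminorms\<close>

text \<open>A sum replaces the supremum over \<open>Q\<close>: it is a seminorm by summing termwise,
  and it differs from the supremum by at most the factor \<open>card Q\<close>.\<close>

definition psum :: "('e \<Rightarrow> ('w \<Rightarrow> real) set) set \<Rightarrow> 'e \<Rightarrow> 'w \<Rightarrow> real" where
  "psum Q x w = (\<Sum>q\<in>Q. rep M (q x) w)"

lemma seminorm_closed: "q \<in> P \<Longrightarrow> x \<in> carrier E \<Longrightarrow> q x \<in> ae_classes M"
  using seminorms[of q] by (auto simp: L0_seminorm_def L0_nonneg_def L0_def)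

lemma rep_seminorm_measurable:
  "q \<in> P \<Longrightarrow> x \<in> carrier E \<Longrightarrow> rep M (q x) \<in> borel_measurable M"
  by (rule rep_measurable) (rule seminorm_closed)

lemma rep_seminorm_nonneg:
  assumes "q \<in> P" "x \<in> carrier E"
  shows "AE w in M. 0 \<le> rep M (q x) w"
proof -
  have "ae_all M (\<lambda>t. t \<ge> 0) (ae_class M (rep M (q x)))"
    using seminorms[OF assms(1)] assms seminorm_closed[OF assms]
    by (auto simp: L0_seminorm_def L0_nonneg_def)
  then show ?thesis using ae_all_class[OF rep_seminorm_measurable[OF assms]] by auto
qed

lemma rep_seminorm_add:
  assumes q: "q \<in> P" and xy: "x \<in> carrier E" "y \<in> carrier E"
  shows "AE w in M. rep M (q (x \<oplus>\<^bsub>E\<^esub> y)) w \<le> rep M (q x) w + rep M (q y) w"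
proof -
  have "ae_le M (q (x \<oplus>\<^bsub>E\<^esub> y)) (ae_map2 M (+) (q x) (q y))"
    using seminorms[OF q] xy by (simp add: L0_seminorm_def L0_def)
  then have "ae_le M (ae_class M (rep M (q (x \<oplus>\<^bsub>E\<^esub> y))))
      (ae_map2 M (+) (ae_class M (rep M (q x))) (ae_class M (rep M (q y))))"
    using q xy seminorm_closed by simp
  then show ?thesis
    using rep_seminorm_measurable[OF q xy(1)] rep_seminorm_measurable[OF q xy(2)]
      rep_seminorm_measurable[OF q E.a_closed[OF xy]]
    by (simp add: ae_map2_class ae_le_class del: ae_class_rep)
qed

lemma rep_seminorm_sc:
  assumes q: "q \<in> P" and x: "x \<in> carrier E" and \<phi>: "\<phi> \<in> borel_measurable M"
  shows "AE w in M. rep M (q (sc \<phi> x)) w = \<bar>\<phi> w\<bar> * rep M (q x) w"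
proof -
  have "ae_class M \<phi> \<in> carrier (L0 M)" using \<phi> by (simp add: L0_def)
  then have "q (sc \<phi> x) = ae_map2 M (*) (ae_map M abs (ae_class M \<phi>)) (q x)"
    using seminorms[OF q] x unfolding L0_seminorm_def sc_def by (simp add: L0_def)
  then have "ae_class M (rep M (q (sc \<phi> x))) =
      ae_map2 M (*) (ae_map M abs (ae_class M \<phi>)) (ae_class M (rep M (q x)))"
    using seminorm_closed[OF q x] seminorm_closed[OF q sc_closed[OF \<phi> x]] by simp
  then show ?thesis
    using \<phi> rep_seminorm_measurable[OF q x] rep_seminorm_measurable[OF q sc_closed[OF \<phi> x]]
    by (simp add: ae_map_class ae_map2_class ae_class_eq_iff del: ae_class_rep)
qed

context
  fixes Q assumes Q: "Q \<subseteq> P" "finite Q"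
begin

lemma psum_measurable: "x \<in> carrier E \<Longrightarrow> psum Q x \<in> borel_measurable M"
  unfolding psum_def using Q by (auto intro!: borel_measurable_sum rep_seminorm_measurable)

lemma psum_add:
  assumes "x \<in> carrier E" "y \<in> carrier E"
  shows "AE w in M. psum Q (x \<oplus>\<^bsub>E\<^esub> y) w \<le> psum Q x w + psum Q y w"
proof -
  have "AE w in M. \<forall>q\<in>Q. rep M (q (x \<oplus>\<^bsub>E\<^esub> y)) w \<le> rep M (q x) w + rep M (q y) w"
    using Q assms by (intro AE_finite_allI rep_seminorm_add) auto
  then show ?thesis
    by eventually_elim (auto simp: psum_def simp flip: sum.distrib intro!: sum_mono)
qed

lemma psum_sc:
  assumes "\<phi> \<in> borel_measurable M" "x \<in> carrier E"
  shows "AE w in M. psum Q (sc \<phi> x) w = \<bar>\<phi> w\<bar> * psum Q x w"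
proof -
  have "AE w in M. \<forall>q\<in>Q. rep M (q (sc \<phi> x)) w = \<bar>\<phi> w\<bar> * rep M (q x) w"
    using Q assms by (intro AE_finite_allI rep_seminorm_sc) auto
  then show ?thesis by eventually_elim (auto simp: psum_def sum_distrib_left intro!: sum.cong)
qed

lemma psum_mono:
  assumes "R \<subseteq> Q" "x \<in> carrier E"
  shows "AE w in M. psum R x w \<le> psum Q x w"
proof -
  have "AE w in M. \<forall>q\<in>Q. 0 \<le> rep M (q x) w"
    using Q assms by (intro AE_finite_allI rep_seminorm_nonneg) auto
  then show ?thesis
    by eventually_elim (use Q assms in \<open>auto simp: psum_def intro!: sum_mono2\<close>)
qed

lemma psum_nonneg: "x \<in> carrier E \<Longrightarrow> AE w in M. 0 \<le> psum Q x w"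
  using psum_mono[of "{}" x] by (simp add: psum_def)

lemma psum_zero: "AE w in M. psum Q \<zero>\<^bsub>E\<^esub> w = 0"
  using psum_sc[of "\<lambda>_. 0" "\<zero>\<^bsub>E\<^esub>"] by simp

text \<open>Homogeneity alone gives locality: where \<open>\<phi>\<close> is 1, the value at
  \<open>x\<close> is the value at \<open>\<phi> x\<close>.\<close>

lemma psum_local:
  assumes "\<phi> \<in> borel_measurable M" "x \<in> carrier E" "y \<in> carrier E" "sc \<phi> x = sc \<phi> y"
  shows "AE w in M. \<phi> w = 1 \<longrightarrow> psum Q x w = psum Q y w"
  using psum_sc[OF assms(1,2)] psum_sc[OF assms(1,3)] unfolding assms(4)
  by eventually_elim auto

lemma L0_ball_psumI:
  assumes e: "e \<in> borel_measurable M" and x: "x \<in> carrier E" and le: "AE w in M. psum Q x w \<le> e w"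
  shows "x \<in> L0_ball M E Q (ae_class M e)"
proof -
  have "ae_le M (q x) (ae_class M e)" if q: "q \<in> Q" for q
  proof -
    have qP: "q \<in> P" using q Q by auto
    have "AE w in M. psum {q} x w \<le> psum Q x w" using q x by (intro psum_mono) auto
    then have "AE w in M. rep M (q x) w \<le> e w"
      using le by eventually_elim (simp add: psum_def)
    then have "ae_le M (ae_class M (rep M (q x))) (ae_class M e)"
      using qP x e by (subst ae_le_class) (auto intro: rep_seminorm_measurable)
    then show ?thesis using qP x seminorm_closed by simp
  qed
  then show ?thesis using Q e x by (subst mem_L0_ball_iff) (auto simp: L0_def)
qed

lemma L0_ball_psumD:
  assumes e: "e \<in> borel_measurable M" and x: "x \<in> L0_ball M E Q (ae_class M e)"
  shows "AE w in M. psum Q x w \<le> real (card Q) * e w"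
proof -
  have *: "x \<in> carrier E" "\<forall>q\<in>Q. ae_le M (q x) (ae_class M e)"
    using x mem_L0_ball_iff[OF Q(1), of "ae_class M e" x] e by (auto simp: L0_def)
  have "AE w in M. rep M (q x) w \<le> e w" if q: "q \<in> Q" for q
  proof -
    have qP: "q \<in> P" using q Q by auto
    have "ae_le M (ae_class M (rep M (q x))) (ae_class M e)"
      using *(2) q qP seminorm_closed[OF qP *(1)] by simp
    then show ?thesis using qP *(1) e by (simp add: ae_le_class rep_seminorm_measurable del: ae_class_rep)
  qed
  then have "AE w in M. \<forall>q\<in>Q. rep M (q x) w \<le> e w"
    using Q by (intro AE_finite_allI) auto
  then show ?thesis
    by eventually_elim (auto simp: psum_def intro!: sum_bounded_above)
qed

text \<open>Domination by a random multiple of \<open>psum Q\<close> gives continuity at zero, and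
  additivity moves it to every point.\<close>

lemma bounded_linear_in_Tc_dual:
  assumes am: "\<And>x. x \<in> carrier E \<Longrightarrow> a x \<in> borel_measurable M"
    and add: "\<And>x y. x \<in> carrier E \<Longrightarrow> y \<in> carrier E \<Longrightarrow> AE w in M. a (x \<oplus>\<^bsub>E\<^esub> y) w = a x w + a y w"
    and hom: "\<And>\<phi> x. \<phi> \<in> borel_measurable M \<Longrightarrow> x \<in> carrier E \<Longrightarrow> AE w in M. a (sc \<phi> x) w = \<phi> w * a x w"
    and K: "K \<in> borel_measurable M" "\<And>w. 0 \<le> K w"
    and bd: "\<And>x. x \<in> carrier E \<Longrightarrow> AE w in M. a x w \<le> K w * psum Q x w"
  shows "(\<lambda>x. ae_class M (a x)) \<in> Tc_dual M E P"
proof -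
  interpret R: random_locally_convex_module M "L0 M" "{ae_map M abs}"
    by (rule random_locally_convex_module_L0) (rule prob_space_axioms)
  let ?g = "\<lambda>x. ae_class M (a x)"
  note [measurable] = K(1)
  \<comment> \<open>The one-sided bound at \<open>-x\<close> bounds \<open>- a x\<close>, because
    \<open>psum\<close> is even.\<close>
  have bd2: "AE w in M. \<bar>a x w\<bar> \<le> K w * psum Q x w" if x: "x \<in> carrier E" for x
  proof -
    let ?n = "\<lambda>_. -1 :: real"
    have "AE w in M. a (sc ?n x) w \<le> K w * psum Q (sc ?n x) w" using x by (intro bd) auto
    moreover have "AE w in M. psum Q (sc ?n x) w = \<bar>?n w\<bar> * psum Q x w" using x by (intro psum_sc) auto
    moreover have "AE w in M. a (sc ?n x) w = ?n w * a x w" using x by (intro hom) auto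
    ultimately show ?thesis using bd[OF x] by eventually_elim auto
  qed
  have gadd: "?g (x \<oplus>\<^bsub>E\<^esub> y) = ?g x \<oplus>\<^bsub>L0 M\<^esub> ?g y" if "x \<in> carrier E" "y \<in> carrier E" for x y
    using that add[OF that] am by (simp add: L0_def ae_map2_class ae_class_eq_iff)
  have "?g (\<xi> \<odot>\<^bsub>E\<^esub> x) = \<xi> \<otimes>\<^bsub>L0 M\<^esub> ?g x" if \<xi>: "\<xi> \<in> carrier (L0 M)" and x: "x \<in> carrier E" for \<xi> x
  proof -
    obtain \<phi> where \<phi>: "\<phi> \<in> borel_measurable M" "\<xi> = ae_class M \<phi>"
      using \<xi> by (auto simp: L0_def elim: ae_classesE)
    have "?g (sc \<phi> x) = \<xi> \<otimes>\<^bsub>L0 M\<^esub> ?g x"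
      using \<phi> x hom[OF \<phi>(1) x] am by (simp add: L0_def ae_map2_class ae_class_eq_iff)
    then show ?thesis by (simp add: \<phi> sc_def)
  qed
  moreover have cl: "?g \<in> carrier E \<rightarrow> carrier (L0 M)" using am by (auto simp: L0_def)
  moreover have "continuous_map (Tc M E P) (Tc M (L0 M) {ae_map M abs}) ?g"
    unfolding continuous_map_def topspace_Tc R.topspace_Tc openin_Tc R.openin_Tc
  proof (intro conjI allI impI)
    fix U assume U: "Tc_open M (L0 M) {ae_map M abs} U"
    show "Tc_open M E P {x \<in> carrier E. ?g x \<in> U}"
      unfolding Tc_open_def
    proof (intro conjI ballI)
      fix x assume "x \<in> {x \<in> carrier E. ?g x \<in> U}"
      then have x: "x \<in> carrier E" "?g x \<in> U" by auto
      then obtain Q' \<epsilon> where Q': "Q' \<subseteq> {ae_map M abs}" "finite Q'" and \<epsilon>: "\<epsilon> \<in> L0_pos M"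
        and sub: "\<forall>y\<in>L0_ball M (L0 M) Q' \<epsilon>. ?g x \<oplus>\<^bsub>L0 M\<^esub> y \<in> U"
        using U unfolding Tc_open_def by blast
      obtain e where e: "e \<in> borel_measurable M" "\<epsilon> = ae_class M e"
        using \<epsilon> by (auto simp: L0_pos_def L0_def elim: ae_classesE)
      have epos: "AE w in M. 0 < e w" using \<epsilon> e by (simp add: L0_pos_def ae_all_class)
      \<comment> \<open>Chosen so that \<open>K * card Q * d\<close> is at most \<open>e\<close>.
        Adding 1 to both factors avoids a zero denominator when \<open>K w = 0\<close> or
        \<open>Q\<close> is empty.\<close>
      define d where "d w = e w / ((K w + 1) * (real (card Q) + 1))" for w
      have dm: "d \<in> borel_measurable M" unfolding d_def using e(1) by measurable
      have "AE w in M. 0 < d w"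
        using epos by eventually_elim (use K(2) in \<open>auto simp: d_def add_nonneg_pos intro!: divide_pos_pos mult_pos_pos\<close>)
      then have "ae_class M d \<in> L0_pos M" using dm by (auto simp: L0_pos_def ae_all_class L0_def)
      moreover have "x \<oplus>\<^bsub>E\<^esub> y \<in> {x \<in> carrier E. ?g x \<in> U}" if y: "y \<in> L0_ball M E Q (ae_class M d)" for y
      proof -
        have yc: "y \<in> carrier E" using y by (simp add: L0_ball_def)
        have "AE w in M. \<bar>a y w\<bar> \<le> e w"
          using bd2[OF yc] L0_ball_psumD[OF dm y] epos
        proof eventually_elim
          case (elim w)
          have "K w * psum Q y w \<le> K w * (real (card Q) * d w)"
            using elim(2) K(2) by (intro mult_left_mono) auto
          also have "\<dots> = (K w / (K w + 1)) * (real (card Q) / (real (card Q) + 1)) * e w"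
            by (simp add: d_def)
          also have "\<dots> \<le> 1 * 1 * e w"
            using K(2)[of w] elim(3) by (intro mult_right_mono mult_mono) (auto simp: divide_simps)
          finally show ?case using elim(1) by simp
        qed
        then have "ae_le M (ae_map M abs (?g y)) \<epsilon>"
          using am[OF yc] e by (simp add: ae_map_class ae_le_class)
        then have "?g y \<in> L0_ball M (L0 M) Q' \<epsilon>"
          using Q' e cl yc R.mem_L0_ball_iff[of Q' \<epsilon> "?g y"] by (auto simp: L0_def)
        then show ?thesis using sub gadd[OF x(1) yc] x(1) yc by auto
      qed
      ultimately show "\<exists>Q \<epsilon>. Q \<subseteq> P \<and> finite Q \<and> \<epsilon> \<in> L0_pos M \<and>
          (\<forall>y\<in>L0_ball M E Q \<epsilon>. x \<oplus>\<^bsub>E\<^esub> y \<in> {x \<in> carrier E. ?g x \<in> U})"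
        using Q by blast
    qed auto
  qed (use cl in auto)
  ultimately show ?thesis using gadd by (simp add: Tc_dual_def)
qed

end

section \<open>Gluing two points along a measurable set\<close>

lemma sc_glue:
  assumes "\<phi> \<in> borel_measurable M" "\<And>w. \<phi> w = 0 \<or> \<phi> w = 1" "x \<in> carrier E" "y \<in> carrier E"
  shows "sc \<phi> (sc \<phi> x \<oplus>\<^bsub>E\<^esub> sc (\<lambda>w. 1 - \<phi> w) y) = sc \<phi> x"
    and "sc (\<lambda>w. 1 - \<phi> w) (sc \<phi> x \<oplus>\<^bsub>E\<^esub> sc (\<lambda>w. 1 - \<phi> w) y) = sc (\<lambda>w. 1 - \<phi> w) y"
proof -
  have *: "\<phi> w * \<phi> w = \<phi> w" "\<phi> w * (1 - \<phi> w) = 0" "(1 - \<phi> w) * \<phi> w = 0"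
    "(1 - \<phi> w) * (1 - \<phi> w) = 1 - \<phi> w" for w
    using assms(2)[of w] by auto
  show "sc \<phi> (sc \<phi> x \<oplus>\<^bsub>E\<^esub> sc (\<lambda>w. 1 - \<phi> w) y) = sc \<phi> x"
    and "sc (\<lambda>w. 1 - \<phi> w) (sc \<phi> x \<oplus>\<^bsub>E\<^esub> sc (\<lambda>w. 1 - \<phi> w) y) = sc (\<lambda>w. 1 - \<phi> w) y"
    using assms by (simp_all add: sc_add_right sc_sc *)
qed

lemma sc_diff_cong:
  assumes "\<phi> \<in> borel_measurable M" "x \<in> carrier E" "y \<in> carrier E" "x' \<in> carrier E" "y' \<in> carrier E"
    and "sc \<phi> x = sc \<phi> x'" "sc \<phi> y = sc \<phi> y'"
  shows "sc \<phi> (x \<oplus>\<^bsub>E\<^esub> sc (\<lambda>_. -1) y) = sc \<phi> (x' \<oplus>\<^bsub>E\<^esub> sc (\<lambda>_. -1) y')"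
proof -
  have *: "sc \<phi> (sc (\<lambda>_. -1) z) = sc (\<lambda>_. -1) (sc \<phi> z)" if "z \<in> carrier E" for z
    using that assms(1) by (simp add: sc_sc)
  show ?thesis using assms by (simp add: sc_add_right *)
qed

end

section \<open>Proper lower semicontinuous convex functions\<close>

locale proper_lsc_convex = random_locally_convex_module M E P
  for M :: "'w measure" and E :: "(('w \<Rightarrow> real) set, 'e, 'm) module_scheme" and P +
  fixes f :: "'e \<Rightarrow> ('w \<Rightarrow> ereal) set"
  assumes concat: "countable_concatenation M E"
    and f: "f \<in> carrier E \<rightarrow> carrier (L0_ext M)"
    and proper: "L0_proper M E f"
    and lsc: "Tc_lsc M E P f"
    and conv: "L0_convex M E f"
begin

definition fr :: "'e \<Rightarrow> 'w \<Rightarrow> ereal" where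
  "fr x = rep M (f x)"

lemma f_class: "x \<in> carrier E \<Longrightarrow> f x \<in> ae_classes M"
  using f by (auto simp: L0_ext_def)

lemma fr_measurable: "x \<in> carrier E \<Longrightarrow> fr x \<in> borel_measurable M"
  unfolding fr_def by (rule rep_measurable) (rule f_class)

lemma ae_class_fr: "x \<in> carrier E \<Longrightarrow> ae_class M (fr x) = f x"
  unfolding fr_def by (rule ae_class_rep) (rule f_class)

lemma fr_gt_MInf: "x \<in> carrier E \<Longrightarrow> AE w in M. -\<infinity> < fr x w"
  using proper ae_all_class[OF fr_measurable, of x "\<lambda>t. -\<infinity> < t"]
  by (simp add: L0_proper_def ae_class_fr)

lemma ex_fr_finite: "\<exists>x\<in>carrier E. AE w in M. \<bar>fr x w\<bar> < \<infinity>"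
proof -
  obtain x where x: "x \<in> carrier E" "ae_all M (\<lambda>t. \<bar>t\<bar> < \<infinity>) (f x)"
    using proper by (auto simp: L0_proper_def L0_dom_def)
  then show ?thesis
    using ae_all_class[OF fr_measurable, of x "\<lambda>t. \<bar>t\<bar> < \<infinity>"]
    by (intro bexI[of _ x]) (auto simp: ae_class_fr)
qed

lemma fr_convex:
  assumes \<phi>: "\<phi> \<in> borel_measurable M" "\<And>w. 0 \<le> \<phi> w \<and> \<phi> w \<le> 1"
    and xy: "x \<in> carrier E" "y \<in> carrier E"
  shows "AE w in M. fr (sc \<phi> x \<oplus>\<^bsub>E\<^esub> sc (\<lambda>w. 1 - \<phi> w) y) w \<le>
    ereal (\<phi> w) * fr x w + ereal (1 - \<phi> w) * fr y w"
proof -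
  let ?z = "sc \<phi> x \<oplus>\<^bsub>E\<^esub> sc (\<lambda>w. 1 - \<phi> w) y"
  have z: "?z \<in> carrier E" using \<phi>(1) xy by simp
  note [measurable] = \<phi>(1) fr_measurable[OF xy(1)] fr_measurable[OF xy(2)]
  have nn: "ae_class M \<phi> \<in> L0_nonneg M" "ae_le M (ae_class M \<phi>) \<one>\<^bsub>L0 M\<^esub>"
    using \<phi> by (auto simp: L0_nonneg_def L0_def ae_all_class ae_le_class)
  have "ae_le M (f ?z) (ae_map2 M (+) (ae_map2 M (*) (L0_embed M (ae_class M \<phi>)) (f x))
      (ae_map2 M (*) (L0_embed M (ae_class M (\<lambda>w. 1 - \<phi> w))) (f y)))"
    using conv nn xy L0_one_minus[OF \<phi>(1)] unfolding L0_convex_def sc_def by metis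
  then show ?thesis
    using z xy by (simp flip: ae_class_fr)
      (simp add: ae_map_class ae_map2_class ae_le_class fr_measurable)
qed

text \<open>Convexity over L^0 already makes \<open>f\<close> local: since \<open>x\<close> equals
  \<open>\<phi> y + (1 - \<phi>) x\<close>, the convexity bound at points with
  \<open>\<phi> w = 1\<close> reads \<open>fr x w \<le> fr y w\<close>, even where
  \<open>fr x\<close> is infinite, as its weight is 0 there.\<close>

lemma fr_local:
  assumes \<phi>: "\<phi> \<in> borel_measurable M" "\<And>w. 0 \<le> \<phi> w \<and> \<phi> w \<le> 1"
    and xy: "x \<in> carrier E" "y \<in> carrier E" "sc \<phi> x = sc \<phi> y"
  shows "AE w in M. \<phi> w = 1 \<longrightarrow> fr x w \<le> fr y w"
proof -
  have "sc \<phi> y \<oplus>\<^bsub>E\<^esub> sc (\<lambda>w. 1 - \<phi> w) x = x" using sc_split[OF \<phi>(1) xy(1)] xy(3) by simp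
  then have "AE w in M. fr x w \<le> ereal (\<phi> w) * fr y w + ereal (1 - \<phi> w) * fr x w"
    using fr_convex[OF \<phi> xy(2,1)] by simp
  then show ?thesis by eventually_elim (auto simp flip: zero_ereal_def one_ereal_def)
qed

lemma fr_lsc:
  assumes "r \<in> borel_measurable M"
  shows "closedin (Tc M E P) {x \<in> carrier E. AE w in M. fr x w \<le> ereal (r w)}"
proof -
  have "ae_le M (f x) (L0_embed M (ae_class M r)) \<longleftrightarrow> (AE w in M. fr x w \<le> ereal (r w))"
    if "x \<in> carrier E" for x
    using that assms by (simp add: ae_map_class ae_le_class fr_measurable flip: ae_class_fr)
  moreover have "closedin (Tc M E P) {x \<in> carrier E. ae_le M (f x) (L0_embed M (ae_class M r))}"
    using lsc assms by (auto simp: Tc_lsc_def L0_def)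
  ultimately show ?thesis by (simp cong: conj_cong)
qed

section \<open>A lower bound in a ball, on a set of positive measure\<close>

text \<open>A point outside a sublevel set may violate its inequality on a tiny set only, and a
  different one for each point of the ball. \<open>B'\<close> is the part of \<open>B\<close> left
  over by all the sets where some point of the ball satisfies it. Were \<open>B'\<close> null, a
  single pasted point would satisfy the inequality a.e. while lying in the ball.\<close>

lemma local_lower_bound:
  assumes x0: "x0 \<in> carrier E" and x1: "x1 \<in> carrier E" and fin: "AE w in M. \<bar>fr x1 w\<bar> < \<infinity>"
    and B: "B \<in> sets M" "prob B > 0" and r: "r \<in> borel_measurable M"
    and less: "AE w in M. w \<in> B \<longrightarrow> ereal (r w) < fr x0 w"
  obtains Q e B' where "Q \<subseteq> P" "finite Q" "e \<in> borel_measurable M" "\<forall>w. 0 < e w"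
    "B' \<in> sets M" "B' \<subseteq> B" "prob B' > 0"
    "\<forall>y\<in>carrier E. AE w in M. w \<in> B' \<longrightarrow>
      psum Q (y \<oplus>\<^bsub>E\<^esub> sc (\<lambda>_. -1) x0) w \<le> e w \<longrightarrow> ereal (r w) < fr y w"
proof -
  let ?d = "\<lambda>x y. x \<oplus>\<^bsub>E\<^esub> sc (\<lambda>_. -1) y"
  note [measurable] = B(1) r fr_measurable[OF x1]
  define I where "I = indicat_real B"
  have Im: "I \<in> borel_measurable M" unfolding I_def by measurable
  have I01: "I w = 0 \<or> I w = 1" for w by (simp add: I_def indicator_def)
  have I: "0 \<le> I w \<and> I w \<le> 1" "0 \<le> 1 - I w \<and> 1 - I w \<le> 1" for w using I01[of w] by auto
  \<comment> \<open>Off \<open>B\<close> the centre is replaced by \<open>x1\<close>, and the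
    threshold \<open>r'\<close> there is the value of \<open>f\<close> at \<open>x1\<close>. Hence
    the centre can violate the sublevel inequality on \<open>B\<close> only.\<close>
  define x where "x = sc I x0 \<oplus>\<^bsub>E\<^esub> sc (\<lambda>w. 1 - I w) x1"
  have x: "x \<in> carrier E" using x0 x1 Im by (simp add: x_def)
  have xB: "sc I x = sc I x0" and xB': "sc (\<lambda>w. 1 - I w) x = sc (\<lambda>w. 1 - I w) x1"
    unfolding x_def by (rule sc_glue[OF Im I01 x0 x1])+
  define r' where "r' w = (if w \<in> B then r w else real_of_ereal (fr x1 w))" for w
  have r'm: "r' \<in> borel_measurable M" unfolding r'_def by measurable
  define L where "L = {y \<in> carrier E. AE w in M. fr y w \<le> ereal (r' w)}"
  have "x \<notin> L"
  proof
    assume "x \<in> L"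
    then have "AE w in M. fr x w \<le> ereal (r' w)" by (simp add: L_def)
    then have "AE w in M. w \<notin> B"
      using less fr_local[OF Im I(1) x0 x xB[symmetric]]
      by eventually_elim (auto simp: r'_def I_def)
    then have "B \<in> null_sets M" using B(1) by (simp add: AE_iff_null_sets)
    then show False using B(2) by (simp add: null_sets_def emeasure_eq_measure)
  qed
  moreover have "openin (Tc M E P) (carrier E - L)"
    using fr_lsc[OF r'm] by (simp add: closedin_def topspace_Tc L_def)
  ultimately obtain Q \<epsilon> where Q: "Q \<subseteq> P" "finite Q" and \<epsilon>: "\<epsilon> \<in> L0_pos M"
    and ball: "\<forall>y\<in>L0_ball M E Q \<epsilon>. x \<oplus>\<^bsub>E\<^esub> y \<in> carrier E - L"
    using x unfolding openin_Tc Tc_open_def by blast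
  obtain e0 where e0: "e0 \<in> borel_measurable M" "\<epsilon> = ae_class M e0"
    using \<epsilon> by (auto simp: L0_pos_def L0_def elim: ae_classesE)
  have e0pos: "AE w in M. 0 < e0 w" using \<epsilon> e0 by (simp add: L0_pos_def ae_all_class)
  \<comment> \<open>Changed on a null set, so that the radius is positive at every point and can
    serve as a denominator.\<close>
  define e where "e w = (if 0 < e0 w then e0 w else 1)" for w
  have em: "e \<in> borel_measurable M" unfolding e_def using e0(1) by measurable
  have epos: "0 < e w" for w by (simp add: e_def)
  have ee: "AE w in M. e w = e0 w" using e0pos by eventually_elim (simp add: e_def)
  note pm = psum_measurable[OF Q]
  have dc: "?d y z \<in> carrier E" if "y \<in> carrier E" "z \<in> carrier E" for y z using that by simp
  have cancel: "x \<oplus>\<^bsub>E\<^esub> ?d y x = y" if "y \<in> carrier E" for y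
  proof -
    have "x \<oplus>\<^bsub>E\<^esub> ?d y x = y \<oplus>\<^bsub>E\<^esub> (sc (\<lambda>_. -1) x \<oplus>\<^bsub>E\<^esub> x)" using that x by (simp add: E.a_ac)
    then show ?thesis using that x by (simp add: neg_cancel)
  qed
  define Y where "Y = {y \<in> carrier E. AE w in M. psum Q (?d y x) w \<le> e w}"
  have YL: "y \<notin> L" if "y \<in> Y" for y
  proof -
    have y: "y \<in> carrier E" "AE w in M. psum Q (?d y x) w \<le> e w" using that by (auto simp: Y_def)
    have "AE w in M. psum Q (?d y x) w \<le> e0 w" using y(2) ee by eventually_elim simp
    then have "?d y x \<in> L0_ball M E Q \<epsilon>"
      unfolding e0(2) using dc y x e0 by (intro L0_ball_psumI[OF Q]) auto
    then show ?thesis using ball cancel[OF y(1)] by auto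
  qed
  have dxx: "?d x x = \<zero>\<^bsub>E\<^esub>" using neg_cancel[OF x] x by (simp add: E.a_comm)
  have xY: "x \<in> Y"
    using psum_zero[OF Q] x epos by (auto simp: Y_def dxx less_imp_le elim!: eventually_mono)
  define N where "N y = {w \<in> space M. fr y w \<le> ereal (r' w)}" for y
  have Nm: "N y \<in> sets M" if "y \<in> carrier E" for y
    unfolding N_def using fr_measurable[OF that] r'm by measurable
  have NY: "N ` Y \<subseteq> sets M" "N ` Y \<noteq> {}" using Nm xY by (auto simp: Y_def)
  obtain A :: "nat \<Rightarrow> 'w set" where A: "range A \<subseteq> N ` Y"
    and cover: "\<forall>B\<in>N ` Y. AE w in M. w \<in> B \<longrightarrow> w \<in> (\<Union>n. A n)"
    by (rule countable_union_ae_cover[OF NY])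
  have "\<exists>y. y \<in> Y \<and> A n = N y" for n using A by auto
  then obtain ys where ys: "\<And>n. ys n \<in> Y" "\<And>n. A n = N (ys n)" by metis
  have ysc: "ys n \<in> carrier E" for n using ys(1)[of n] by (simp add: Y_def)
  have Am: "A n \<in> sets M" for n using ys(2) Nm[OF ysc] by simp
  let ?U = "\<Union>n. A n"
  have Um: "?U \<in> sets M" using Am by auto
  \<comment> \<open>Index 0 is reserved for the complement of \<open>?U\<close>, where the pasted
    point is the centre \<open>x\<close>; piece \<open>Suc m\<close> carries the point
    \<open>ys m\<close>.\<close>
  define D where "D n = (case n of 0 \<Rightarrow> space M - ?U | Suc m \<Rightarrow> disjointed A m)" for n
  define z where "z n = (case n of 0 \<Rightarrow> x | Suc m \<Rightarrow> ys m)" for n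
  have zY: "z n \<in> Y" for n using xY ys(1) by (simp add: z_def split: nat.split)
  have zc: "z n \<in> carrier E" for n using zY[of n] by (simp add: Y_def)
  have Dm: "D n \<in> sets M" for n
    using Um Am by (auto simp: D_def disjointed_def split: nat.split)
  have disj: "disjoint_family D"
    unfolding disjoint_family_on_def
  proof (intro ballI impI)
    fix m n :: nat assume "m \<noteq> n"
    moreover have "disjointed A i \<inter> disjointed A j = {}" if "i \<noteq> j" for i j
      using disjoint_family_disjointed[of A] that by (auto simp: disjoint_family_on_def)
    moreover have "disjointed A i \<subseteq> ?U" for i using disjointed_subset[of A i] by auto
    ultimately show "D m \<inter> D n = {}"
      by (cases m; cases n) (auto simp: D_def)
  qed
  have DU: "(\<Union>n. D (Suc n)) = ?U" by (simp add: D_def UN_disjointed_eq)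
  have "(\<Union>n. D n) = D 0 \<union> (\<Union>n. D (Suc n))"
    by (auto) (metis not0_implies_Suc)
  then have Dsp: "(\<Union>n. D n) = space M"
    unfolding DU using sets.sets_into_space[OF Um] by (auto simp: D_def)
  have "range z \<subseteq> carrier E \<and> range D \<subseteq> sets M \<and> disjoint_family D \<and> (\<Union>n. D n) = space M"
    using zc Dm disj Dsp by auto
  from concat[unfolded countable_concatenation_def, rule_format, OF this]
  obtain y where y: "y \<in> carrier E"
    "\<And>n. sc (indicat_real (D n)) y = sc (indicat_real (D n)) (z n)"
    unfolding L0_indicator_def sc_def by auto
  have indm: "indicat_real (D n) \<in> borel_measurable M" for n using Dm by simp
  have "AE w in M. \<forall>n. w \<in> D n \<longrightarrow> psum Q (?d y x) w \<le> e w"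
    unfolding AE_all_countable
  proof
    fix n
    have "sc (indicat_real (D n)) (?d y x) = sc (indicat_real (D n)) (?d (z n) x)"
      by (rule sc_diff_cong) (use indm y zc x in auto)
    from psum_local[OF Q indm dc[OF y(1) x] dc[OF zc x] this]
    have "AE w in M. indicat_real (D n) w = 1 \<longrightarrow> psum Q (?d y x) w = psum Q (?d (z n) x) w" .
    moreover have "AE w in M. psum Q (?d (z n) x) w \<le> e w" using zY[of n] by (simp add: Y_def)
    ultimately show "AE w in M. w \<in> D n \<longrightarrow> psum Q (?d y x) w \<le> e w"
      by eventually_elim auto
  qed
  then have "AE w in M. psum Q (?d y x) w \<le> e w"
    using AE_space by eventually_elim (use Dsp in blast)
  then have yY: "y \<in> Y" using y by (simp add: Y_def)
  have "AE w in M. \<forall>n. w \<in> D n \<longrightarrow> fr y w \<le> fr (z n) w"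
    unfolding AE_all_countable
  proof
    fix n
    have "AE w in M. indicat_real (D n) w = 1 \<longrightarrow> fr y w \<le> fr (z n) w"
      by (rule fr_local[OF indm _ y(1) zc y(2)]) (simp add: indicator_def)
    then show "AE w in M. w \<in> D n \<longrightarrow> fr y w \<le> fr (z n) w" by eventually_elim auto
  qed
  then have yU: "AE w in M. w \<in> ?U \<longrightarrow> fr y w \<le> ereal (r' w)"
  proof eventually_elim
    case (elim w)
    show ?case
    proof
      assume "w \<in> ?U"
      then obtain n where n: "w \<in> D (Suc n)" using DU by blast
      then have "w \<in> N (ys n)" using disjointed_subset[of A n] ys(2) by (auto simp: D_def)
      then have "fr (z (Suc n)) w \<le> ereal (r' w)" by (simp add: N_def z_def)
      then show "fr y w \<le> ereal (r' w)" using elim n order_trans by blast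
    qed
  qed
  \<comment> \<open>Off \<open>B\<close> the centre itself meets the threshold, so \<open>?U\<close>
    covers the complement of \<open>B\<close> up to a null set.\<close>
  have xU: "AE w in M. w \<notin> B \<longrightarrow> w \<in> ?U"
  proof -
    have "AE w in M. w \<in> N x \<longrightarrow> w \<in> ?U" using xY by (intro cover[rule_format]) auto
    moreover have "AE w in M. 1 - I w = 1 \<longrightarrow> fr x w \<le> fr x1 w"
      using Im I(2) by (intro fr_local[OF _ _ x x1 xB']) auto
    ultimately show ?thesis using fin AE_space
    proof eventually_elim
      case (elim w)
      then show ?case by (cases "fr x1 w") (auto simp: N_def r'_def I_def)
    qed
  qed
  define B' where "B' = B - ?U"
  have B'm: "B' \<in> sets M" using B Um by (auto simp: B'_def)
  have "prob B' \<noteq> 0"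
  proof
    assume "prob B' = 0"
    then have "B' \<in> null_sets M" using B'm by (simp add: null_sets_def emeasure_eq_measure)
    then have "AE w in M. w \<notin> B'" by (rule AE_not_in)
    then have "AE w in M. fr y w \<le> ereal (r' w)"
      using xU yU by eventually_elim (auto simp: B'_def)
    then show False using YL[OF yY] y by (simp add: L_def)
  qed
  then have B'pos: "prob B' > 0" by (simp add: zero_less_measure_iff)
  show thesis
  proof (rule that[OF Q em _ B'm _ B'pos]; (rule allI ballI)?)
    show "0 < e w" for w by (rule epos)
    show "B' \<subseteq> B" by (auto simp: B'_def)
  next
    fix v assume v: "v \<in> carrier E"
    \<comment> \<open>\<open>v\<close> may leave the ball on part of the space. Replacing it there
      by the centre gives a point \<open>u\<close> of the ball that agrees with \<open>v\<close> on
      the set in question.\<close>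
    define J where "J w = (if psum Q (?d v x) w \<le> e w then 1 else 0 :: real)" for w
    have Jm: "J \<in> borel_measurable M"
      unfolding J_def using pm[OF dc[OF v x]] em by measurable
    have J01: "J w = 0 \<or> J w = 1" for w by (simp add: J_def)
    define u where "u = sc J v \<oplus>\<^bsub>E\<^esub> sc (\<lambda>w. 1 - J w) x"
    have u: "u \<in> carrier E" using v x Jm by (simp add: u_def)
    have uJ: "sc J u = sc J v" and uJ': "sc (\<lambda>w. 1 - J w) u = sc (\<lambda>w. 1 - J w) x"
      unfolding u_def by (rule sc_glue[OF Jm J01 v x])+
    have J'm: "(\<lambda>w. 1 - J w) \<in> borel_measurable M" using Jm by measurable
    have "AE w in M. J w = 1 \<longrightarrow> psum Q (?d u x) w = psum Q (?d v x) w"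
      by (rule psum_local[OF Q Jm dc[OF u x] dc[OF v x] sc_diff_cong[OF Jm u x v x uJ refl]])
    moreover have "AE w in M. 1 - J w = 1 \<longrightarrow> psum Q (?d u x) w = psum Q (?d x x) w"
      by (rule psum_local[OF Q J'm dc[OF u x] dc[OF x x] sc_diff_cong[OF J'm u x x x uJ' refl]])
    ultimately have "AE w in M. psum Q (?d u x) w \<le> e w"
      using psum_zero[OF Q] unfolding dxx
      by eventually_elim (use epos in \<open>auto simp: J_def less_imp_le split: if_splits\<close>)
    then have "u \<in> Y" using u by (simp add: Y_def)
    then have "AE w in M. w \<in> N u \<longrightarrow> w \<in> ?U" by (intro cover[rule_format]) auto
    moreover have "AE w in M. J w = 1 \<longrightarrow> fr u w \<le> fr v w"
      using J01 by (intro fr_local[OF Jm _ u v uJ]) (metis order_refl zero_le_one)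
    moreover have "AE w in M. I w = 1 \<longrightarrow> psum Q (?d v x) w = psum Q (?d v x0) w"
      by (rule psum_local[OF Q Im dc[OF v x] dc[OF v x0] sc_diff_cong[OF Im v x v x0 refl xB]])
    ultimately show "AE w in M. w \<in> B' \<longrightarrow> psum Q (?d v x0) w \<le> e w \<longrightarrow> ereal (r w) < fr v w"
      using AE_space
    proof eventually_elim
      case (elim w)
      show ?case
      proof (intro impI)
        assume w: "w \<in> B'" "psum Q (?d v x0) w \<le> e w"
        then have "I w = 1" "w \<in> B" "w \<notin> ?U" by (auto simp: B'_def I_def)
        then have "J w = 1" "w \<notin> N u" using elim w by (auto simp: J_def)
        then have "ereal (r w) < fr u w" using elim(4) \<open>w \<in> B\<close> by (auto simp: N_def r'_def)
        also have "\<dots> \<le> fr v w" using elim(2) \<open>J w = 1\<close> by simp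
        finally show "ereal (r w) < fr v w" .
      qed
    qed
  qed
qed

section \<open>Affine minorants from the sandwich theorem\<close>

text \<open>The sandwich theorem is applied after moving \<open>x\<close> to the origin and
  subtracting \<open>r\<close>. Setting the function to 0 off \<open>B\<close> keeps it convex and
  above \<open>-p\<close> there, so a bound known on \<open>B\<close> alone becomes one on the whole
  space.\<close>

lemma affine_minorant:
  assumes Q: "Q \<subseteq> P" "finite Q" and x: "x \<in> carrier E" and B: "B \<in> sets M"
    and r: "r \<in> borel_measurable M" and K: "K \<in> borel_measurable M" "\<And>w. 0 \<le> K w"
    and low: "\<And>y. y \<in> carrier E \<Longrightarrow> AE w in M. w \<in> B \<longrightarrow>
      ereal (r w - K w * psum Q (y \<oplus>\<^bsub>E\<^esub> sc (\<lambda>_. -1) x) w) \<le> fr y w"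
  obtains a where "\<forall>x\<in>carrier E. a x \<in> borel_measurable M"
    "(\<lambda>x. ae_class M (a x)) \<in> Tc_dual M E P"
    "\<forall>y\<in>carrier E. AE w in M. w \<in> B \<longrightarrow> ereal (a y w - a x w + r w) \<le> fr y w"
proof -
  note pm = psum_measurable[OF Q]
  note [measurable] = B r K(1)
  define F where "F z w = (if w \<in> B then fr (z \<oplus>\<^bsub>E\<^esub> x) w - ereal (r w) else 0)" for z w
  define p where "p z w = K w * psum Q z w" for z w
  have pme: "p z \<in> borel_measurable M" if "z \<in> carrier E" for z
    unfolding p_def using pm[OF that] by measurable
  have Fme: "F z \<in> borel_measurable M" if "z \<in> carrier E" for z
  proof -
    have [measurable]: "fr (z \<oplus>\<^bsub>E\<^esub> x) \<in> borel_measurable M" using that x by (intro fr_measurable) auto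
    show ?thesis unfolding F_def by measurable
  qed
  have padd: "AE w in M. p (y \<oplus>\<^bsub>E\<^esub> z) w \<le> p y w + p z w"
    if "y \<in> carrier E" "z \<in> carrier E" for y z
    using psum_add[OF Q that]
    by eventually_elim (use K(2) in \<open>auto simp: p_def simp flip: distrib_left intro: mult_left_mono\<close>)
  have psc: "AE w in M. p (sc \<phi> z) w = \<bar>\<phi> w\<bar> * p z w"
    if "\<phi> \<in> borel_measurable M" "z \<in> carrier E" for \<phi> z
    using psum_sc[OF Q that] by eventually_elim (simp add: p_def)
  have sub_add: "z \<oplus>\<^bsub>E\<^esub> x \<oplus>\<^bsub>E\<^esub> sc (\<lambda>_. -1) x = z" if "z \<in> carrier E" for z
  proof -
    have "z \<oplus>\<^bsub>E\<^esub> x \<oplus>\<^bsub>E\<^esub> sc (\<lambda>_. -1) x = z \<oplus>\<^bsub>E\<^esub> (sc (\<lambda>_. -1) x \<oplus>\<^bsub>E\<^esub> x)"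
      using that x by (simp add: E.a_ac)
    then show ?thesis using that x by (simp add: neg_cancel)
  qed
  have Fp: "AE w in M. ereal (- p z w) \<le> F z w" if z: "z \<in> carrier E" for z
  proof -
    have "AE w in M. w \<in> B \<longrightarrow> ereal (r w - K w * psum Q z w) \<le> fr (z \<oplus>\<^bsub>E\<^esub> x) w"
      using low[of "z \<oplus>\<^bsub>E\<^esub> x"] sub_add[OF z] z x by simp
    with psum_nonneg[OF Q z] show ?thesis
    proof eventually_elim
      case (elim w)
      then show ?case using K(2)[of w]
        by (cases "fr (z \<oplus>\<^bsub>E\<^esub> x) w") (auto simp: F_def p_def zero_ereal_def)
    qed
  qed
  have Fc: "AE w in M. F (sc \<phi> y \<oplus>\<^bsub>E\<^esub> sc (\<lambda>w. 1 - \<phi> w) z) w \<le> ereal (\<phi> w) * F y w + ereal (1 - \<phi> w) * F z w"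
    if \<phi>: "\<phi> \<in> borel_measurable M" "\<And>w. 0 \<le> \<phi> w \<and> \<phi> w \<le> 1" and yz: "y \<in> carrier E" "z \<in> carrier E"
    for \<phi> y z
  proof -
    have yzx: "y \<oplus>\<^bsub>E\<^esub> x \<in> carrier E" "z \<oplus>\<^bsub>E\<^esub> x \<in> carrier E" using yz x by auto
    have "sc \<phi> (y \<oplus>\<^bsub>E\<^esub> x) \<oplus>\<^bsub>E\<^esub> sc (\<lambda>w. 1 - \<phi> w) (z \<oplus>\<^bsub>E\<^esub> x) =
        sc \<phi> y \<oplus>\<^bsub>E\<^esub> sc (\<lambda>w. 1 - \<phi> w) z \<oplus>\<^bsub>E\<^esub> (sc \<phi> x \<oplus>\<^bsub>E\<^esub> sc (\<lambda>w. 1 - \<phi> w) x)"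
      using \<phi>(1) yz x by (simp add: sc_add_right E.a_ac)
    also have "\<dots> = sc \<phi> y \<oplus>\<^bsub>E\<^esub> sc (\<lambda>w. 1 - \<phi> w) z \<oplus>\<^bsub>E\<^esub> x"
      using \<phi>(1) x by (simp add: sc_split)
    finally have "AE w in M. fr (sc \<phi> y \<oplus>\<^bsub>E\<^esub> sc (\<lambda>w. 1 - \<phi> w) z \<oplus>\<^bsub>E\<^esub> x) w \<le>
        ereal (\<phi> w) * fr (y \<oplus>\<^bsub>E\<^esub> x) w + ereal (1 - \<phi> w) * fr (z \<oplus>\<^bsub>E\<^esub> x) w"
      using fr_convex[OF \<phi> yzx] by simp
    with fr_gt_MInf[OF yzx(1)] fr_gt_MInf[OF yzx(2)] show ?thesis
      by eventually_elim (use \<phi>(2) in \<open>auto simp: F_def intro!: ereal_convex_shift\<close>)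
  qed
  show thesis
  proof (rule sandwich[of p F, OF pme padd psc Fp Fc Fme])
    fix a assume am: "\<And>x. x \<in> carrier E \<Longrightarrow> a x \<in> borel_measurable M"
      and aF: "\<And>x. x \<in> carrier E \<Longrightarrow> AE w in M. ereal (a x w) \<le> F x w"
      and ap: "\<And>x. x \<in> carrier E \<Longrightarrow> AE w in M. a x w \<le> p x w"
      and add: "\<And>x y. x \<in> carrier E \<Longrightarrow> y \<in> carrier E \<Longrightarrow> AE w in M. a (x \<oplus>\<^bsub>E\<^esub> y) w = a x w + a y w"
      and hom: "\<And>\<phi> x. \<phi> \<in> borel_measurable M \<Longrightarrow> x \<in> carrier E \<Longrightarrow> AE w in M. a (sc \<phi> x) w = \<phi> w * a x w"
    show thesis
    proof (rule that[of a]; (rule ballI)?)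
      show "(\<lambda>x. ae_class M (a x)) \<in> Tc_dual M E P"
        by (rule bounded_linear_in_Tc_dual[OF Q am add hom K]) (use ap in \<open>auto simp: p_def\<close>)
      fix y assume y: "y \<in> carrier E"
      let ?z = "y \<oplus>\<^bsub>E\<^esub> sc (\<lambda>_. -1) x"
      have z: "?z \<in> carrier E" using x y by simp
      have "?z \<oplus>\<^bsub>E\<^esub> x = y \<oplus>\<^bsub>E\<^esub> (sc (\<lambda>_. -1) x \<oplus>\<^bsub>E\<^esub> x)" using x y by (simp add: E.a_ac)
      then have zx: "?z \<oplus>\<^bsub>E\<^esub> x = y" using x y by (simp add: neg_cancel)
      have "AE w in M. a (?z \<oplus>\<^bsub>E\<^esub> x) w = a ?z w + a x w" by (rule add[OF z x])
      then have "AE w in M. a y w = a ?z w + a x w" unfolding zx .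
      with aF[OF z] show "AE w in M. w \<in> B \<longrightarrow> ereal (a y w - a x w + r w) \<le> fr y w"
      proof eventually_elim
        case (elim w)
        then show ?case unfolding F_def zx by (cases "fr y w") auto
      qed
    qed (use am in auto)
  qed
qed

section \<open>Lower bounds with linear growth\<close>

text \<open>On the segment from \<open>x1\<close> to \<open>y\<close> take the point with factor
  \<open>t\<close> that is still in the ball. There \<open>f\<close> exceeds \<open>c - 1\<close>,
  and convexity yields f(y) > c - 1/t where f(y) is real, with 1/t at most 1 plus the distance
  divided by \<open>e\<close>.\<close>

lemma lower_bound_at_finite_point:
  assumes x1: "x1 \<in> carrier E" and fin: "AE w in M. \<bar>fr x1 w\<bar> < \<infinity>"
    and B: "B \<in> sets M" "prob B > 0"
  obtains Q e B' where "Q \<subseteq> P" "finite Q" "e \<in> borel_measurable M" "\<forall>w. 0 < e w"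
    "B' \<in> sets M" "B' \<subseteq> B" "prob B' > 0"
    "\<forall>y\<in>carrier E. AE w in M. w \<in> B' \<longrightarrow>
      ereal (real_of_ereal (fr x1 w) - 1 - psum Q (y \<oplus>\<^bsub>E\<^esub> sc (\<lambda>_. -1) x1) w / e w) \<le> fr y w"
proof -
  let ?d = "\<lambda>y. y \<oplus>\<^bsub>E\<^esub> sc (\<lambda>_. -1) x1"
  define c where "c w = real_of_ereal (fr x1 w)" for w
  have cm: "(\<lambda>w. c w - 1) \<in> borel_measurable M" unfolding c_def using fr_measurable[OF x1] by measurable
  have cf: "AE w in M. fr x1 w = ereal (c w)"
    using fin
  proof eventually_elim
    case (elim w)
    then show ?case by (cases "fr x1 w") (auto simp: c_def)
  qed
  \<comment> \<open>The local bound asks for strict inequality at the centre; the loss of 1 provides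
    it.\<close>
  then have "AE w in M. w \<in> B \<longrightarrow> ereal (c w - 1) < fr x1 w"
    by eventually_elim auto
  from local_lower_bound[OF x1 x1 fin B cm this]
  obtain Q e B' where Q: "Q \<subseteq> P" "finite Q" and e: "e \<in> borel_measurable M" "\<forall>w. 0 < e w"
    and B': "B' \<in> sets M" "B' \<subseteq> B" "prob B' > 0"
    and low: "\<forall>y\<in>carrier E. AE w in M. w \<in> B' \<longrightarrow> psum Q (?d y) w \<le> e w \<longrightarrow> ereal (c w - 1) < fr y w"
    by blast
  note e' = e(2)[rule_format]
  show thesis
  proof (rule that[OF Q e B']; rule ballI)
    fix y assume y: "y \<in> carrier E"
    have dy: "?d y \<in> carrier E" using y x1 by simp
    \<comment> \<open>The largest factor up to 1 that shrinks \<open>y - x1\<close> into the ball at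
      \<open>w\<close>; it varies with \<open>w\<close>.\<close>
    define t where "t w = e w / max (e w) (psum Q (?d y) w)" for w
    have tm: "t \<in> borel_measurable M"
      unfolding t_def using e(1) psum_measurable[OF Q dy] by measurable
    have t: "0 < t w" "t w \<le> 1" for w
      using e'[of w] by (auto simp: t_def max_def divide_simps)
    define u where "u = sc t y \<oplus>\<^bsub>E\<^esub> sc (\<lambda>w. 1 - t w) x1"
    have u: "u \<in> carrier E" using y x1 tm by (simp add: u_def)
    have "?d u = sc t y \<oplus>\<^bsub>E\<^esub> (sc (\<lambda>w. 1 - t w) x1 \<oplus>\<^bsub>E\<^esub> sc (\<lambda>_. -1) x1)"
      using y x1 tm by (simp add: u_def E.a_ac)
    also have "sc (\<lambda>w. 1 - t w) x1 \<oplus>\<^bsub>E\<^esub> sc (\<lambda>_. -1) x1 = sc (\<lambda>w. t w * -1) x1"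
      using sc_add_left[of "\<lambda>w. 1 - t w" "\<lambda>_. -1" x1] x1 tm by simp
    also have "sc t y \<oplus>\<^bsub>E\<^esub> \<dots> = sc t (?d y)"
      using y x1 tm by (simp add: sc_add_right sc_sc)
    finally have du: "?d u = sc t (?d y)" .
    have "AE w in M. psum Q (?d u) w = \<bar>t w\<bar> * psum Q (?d y) w"
      unfolding du by (rule psum_sc[OF Q tm dy])
    moreover have "AE w in M. fr u w \<le> ereal (t w) * fr y w + ereal (1 - t w) * fr x1 w"
      unfolding u_def by (rule fr_convex[OF tm _ y x1]) (use t less_imp_le in auto)
    ultimately have "AE w in M. w \<in> B' \<longrightarrow> ereal (c w - 1 - psum Q (?d y) w / e w) \<le> fr y w"
      using low[rule_format, OF u] cf psum_nonneg[OF Q dy] fr_gt_MInf[OF y]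
    proof eventually_elim
      case (elim w)
      let ?p = "psum Q (?d y) w"
      show ?case
      proof
        assume w: "w \<in> B'"
        have "t w * ?p \<le> e w" using e'[of w] elim(5)
          by (auto simp: t_def max_def divide_simps)
        then have "ereal (c w - 1) < fr u w" using elim(1,3) w t(1)[of w] by simp
        also note elim(2)
        finally have *: "ereal (c w - 1) < ereal (t w) * fr y w + ereal (1 - t w) * ereal (c w)"
          unfolding elim(4) .
        show "ereal (c w - 1 - ?p / e w) \<le> fr y w"
        proof (cases "fr y w")
          case (real v)
          then have "c w - 1 < t w * v + (1 - t w) * c w" using * by simp
          then have "t w * (c w - v) < 1" by (simp add: algebra_simps)
          then have "c w - v < 1 / t w" using t(1)[of w] by (simp add: field_simps)
          also have "1 / t w = max (e w) ?p / e w" by (simp add: t_def)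
          also have "\<dots> \<le> 1 + ?p / e w" using e'[of w] elim(5) by (auto simp: max_def field_simps)
          finally show ?thesis using real by simp
        qed (use elim(6) in auto)
      qed
    qed
    then show "AE w in M. w \<in> B' \<longrightarrow> ereal (real_of_ereal (fr x1 w) - 1 - psum Q (?d y) w / e w) \<le> fr y w"
      by (simp add: c_def)
  qed
qed

text \<open>Near \<open>x\<close> the local bound gives \<open>r\<close>. Away from \<open>x\<close>
  the growth bound at \<open>x1\<close> takes over; it may fall short of \<open>r\<close>, but a
  fixed deficit is absorbed by the slope once the distance exceeds \<open>e2\<close>.\<close>

lemma lower_bound:
  fixes r :: real
  assumes x: "x \<in> carrier E" and B: "B \<in> sets M" "prob B > 0"
    and less: "AE w in M. w \<in> B \<longrightarrow> ereal r < fr x w"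
  obtains Q K B' where "Q \<subseteq> P" "finite Q" "K \<in> borel_measurable M" "\<forall>w. 0 \<le> K w"
    "B' \<in> sets M" "B' \<subseteq> B" "prob B' > 0"
    "\<forall>y\<in>carrier E. AE w in M. w \<in> B' \<longrightarrow>
      ereal (r - K w * psum Q (y \<oplus>\<^bsub>E\<^esub> sc (\<lambda>_. -1) x) w) \<le> fr y w"
proof -
  let ?d = "\<lambda>x y. x \<oplus>\<^bsub>E\<^esub> sc (\<lambda>_. -1) y"
  obtain x1 where x1: "x1 \<in> carrier E" and fin: "AE w in M. \<bar>fr x1 w\<bar> < \<infinity>"
    using ex_fr_finite by blast
  obtain Q1 e1 B1 where Q1: "Q1 \<subseteq> P" "finite Q1" and e1: "e1 \<in> borel_measurable M" "\<forall>w. 0 < e1 w"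
    and B1: "B1 \<in> sets M" "B1 \<subseteq> B" "prob B1 > 0"
    and low1: "\<forall>y\<in>carrier E. AE w in M. w \<in> B1 \<longrightarrow>
      ereal (real_of_ereal (fr x1 w) - 1 - psum Q1 (?d y x1) w / e1 w) \<le> fr y w"
    by (rule lower_bound_at_finite_point[OF x1 fin B])
  \<comment> \<open>The second bound is sought inside \<open>B1\<close>, so that both hold on the
    final set.\<close>
  have "AE w in M. w \<in> B1 \<longrightarrow> ereal r < fr x w" using less by eventually_elim (use B1 in auto)
  from local_lower_bound[OF x x1 fin B1(1,3) borel_measurable_const this]
  obtain Q2 e2 B2 where Q2: "Q2 \<subseteq> P" "finite Q2" and e2: "e2 \<in> borel_measurable M" "\<forall>w. 0 < e2 w"
    and B2: "B2 \<in> sets M" "B2 \<subseteq> B1" "prob B2 > 0"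
    and low2: "\<forall>y\<in>carrier E. AE w in M. w \<in> B2 \<longrightarrow> psum Q2 (?d y x) w \<le> e2 w \<longrightarrow> ereal r < fr y w"
    by blast
  note e1' = e1(2)[rule_format] and e2' = e2(2)[rule_format]
  let ?Q = "Q1 \<union> Q2"
  have Q: "?Q \<subseteq> P" "finite ?Q" using Q1 Q2 by auto
  have xx: "?d x x1 \<in> carrier E" using x x1 by simp
  \<comment> \<open>\<open>b\<close> is the amount by which the growth bound at \<open>x1\<close>
    misses \<open>r\<close> at the point \<open>x\<close>. In \<open>K\<close>, the summand
    \<open>1 / e1\<close> is the slope of that bound, and \<open>b / e2\<close> compensates
    \<open>b\<close> at distances beyond \<open>e2\<close>.\<close>
  define b where "b w = max 0 (r - real_of_ereal (fr x1 w) + 1 + psum Q1 (?d x x1) w / e1 w)" for w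
  define K where "K w = 1 / e1 w + b w / e2 w" for w
  have Km: "K \<in> borel_measurable M"
    unfolding K_def b_def using e1(1) e2(1) fr_measurable[OF x1] psum_measurable[OF Q1 xx] by measurable
  have b0: "0 \<le> b w" for w by (simp add: b_def)
  have K0: "0 \<le> K w" for w using e1'[of w] e2'[of w] b0[of w] by (simp add: K_def less_imp_le)
  show thesis
  proof (rule that[OF Q Km _ B2(1) _ B2(3)]; (rule allI ballI)?)
    show "0 \<le> K w" for w by (rule K0)
    show "B2 \<subseteq> B" using B1 B2 by auto
  next
    fix y assume y: "y \<in> carrier E"
    have yx: "?d y x \<in> carrier E" using y x by simp
    have "?d y x \<oplus>\<^bsub>E\<^esub> ?d x x1 = ?d y x1 \<oplus>\<^bsub>E\<^esub> (sc (\<lambda>_. -1) x \<oplus>\<^bsub>E\<^esub> x)"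
      using x x1 y by (simp add: E.a_ac)
    also have "\<dots> = ?d y x1" using x x1 y by (simp add: neg_cancel)
    finally have "AE w in M. psum Q1 (?d y x1) w \<le> psum Q1 (?d y x) w + psum Q1 (?d x x1) w"
      using psum_add[OF Q1 yx xx] by simp
    moreover have "AE w in M. psum Q1 (?d y x) w \<le> psum ?Q (?d y x) w" 
      by (rule psum_mono[OF Q _ yx]) auto
    moreover have "AE w in M. psum Q2 (?d y x) w \<le> psum ?Q (?d y x) w" 
      by (rule psum_mono[OF Q _ yx]) auto
    ultimately show "AE w in M. w \<in> B2 \<longrightarrow> ereal (r - K w * psum ?Q (?d y x) w) \<le> fr y w"
      using low1[rule_format, OF y] low2[rule_format, OF y] psum_nonneg[OF Q yx]
    proof eventually_elim
      case (elim w)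
      let ?p = "psum ?Q (?d y x) w"
      show ?case
      proof
        assume w: "w \<in> B2"
        show "ereal (r - K w * ?p) \<le> fr y w"
        proof (cases "?p \<le> e2 w")
          case True
          have "ereal (r - K w * ?p) \<le> ereal r" using K0[of w] elim(6) by simp
          also have "\<dots> < fr y w" using True elim(3,5) w by simp
          finally show ?thesis by simp
        next
          case False
          have "b w \<le> b w / e2 w * ?p"
            using False e2'[of w] b0[of w] mult_left_mono[of "e2 w" ?p "b w"] by (simp add: field_simps)
          moreover have "psum Q1 (?d y x1) w / e1 w \<le> (?p + psum Q1 (?d x x1) w) / e1 w"
            using elim(1,2) e1'[of w] by (intro divide_right_mono) auto
          moreover have "r - real_of_ereal (fr x1 w) + 1 + psum Q1 (?d x x1) w / e1 w \<le> b w"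
            by (simp add: b_def)
          ultimately have "r - K w * ?p \<le> real_of_ereal (fr x1 w) - 1 - psum Q1 (?d y x1) w / e1 w"
            by (simp add: K_def algebra_simps add_divide_distrib)
          then have "ereal (r - K w * ?p) \<le> ereal (real_of_ereal (fr x1 w) - 1 - psum Q1 (?d y x1) w / e1 w)"
            by simp
          also have "\<dots> \<le> fr y w" using elim(4) w B2 by auto
          finally show ?thesis .
        qed
      qed
    qed
  qed
qed

section \<open>Equality of the function and its biconjugate\<close>

lemma Tc_biconjugate_eq:
  assumes x: "x \<in> carrier E"
  shows "Tc_biconjugate M E P f x = f x"
proof -
  let ?D = "Tc_dual M E P"
  have gcl: "g y \<in> ae_classes M" if "g \<in> ?D" "y \<in> carrier E" for g y
    using that by (auto simp: Tc_dual_def L0_def)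
  note gm = rep_measurable[OF gcl]
  define h where "h g y w = ereal (rep M (g y) w) - fr y w" for g :: "'e \<Rightarrow> ('w \<Rightarrow> real) set" and y w
  have hm: "h g y \<in> borel_measurable M" if "g \<in> ?D" "y \<in> carrier E" for g y
    unfolding h_def using gm[OF that] fr_measurable[OF that(2)] by measurable
  have emb: "ae_map2 M (-) (L0_embed M (g y)) X = ae_class M (\<lambda>w. ereal (rep M (g y) w) - rep M X w)"
    if "g \<in> ?D" "y \<in> carrier E" "X \<in> ae_classes M" for g y X
  proof -
    have "ae_map2 M (-) (L0_embed M (ae_class M (rep M (g y)))) (ae_class M (rep M X)) =
        ae_class M (\<lambda>w. ereal (rep M (g y) w) - rep M X w)"
      using gm[OF that(1,2)] rep_measurable[OF that(3)]
      by (subst ae_map_class) (auto simp: ae_map2_class simp del: ae_class_rep)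
    then show ?thesis using gcl[OF that(1,2)] that(3) by simp
  qed
  have cS: "Tc_conjugate M E f g = \<Squnion>\<^bsub>L0_ext M\<^esub>((\<lambda>y. ae_class M (h g y)) ` carrier E)"
    if "g \<in> ?D" for g
    unfolding Tc_conjugate_def h_def fr_def using emb[OF that] f_class
    by (intro arg_cong[of _ _ "\<lambda>A. \<Squnion>\<^bsub>L0_ext M\<^esub> A"] image_cong) auto
  define C where "C g = rep M (Tc_conjugate M E f g)" for g
  note cc = L0_ext_Sup(1)[OF hm cS]
  have Cm: "C g \<in> borel_measurable M" if "g \<in> ?D" for g
    unfolding C_def using that by (intro rep_measurable cc) auto
  have Cup: "AE w in M. h g y w \<le> C g w" if "g \<in> ?D" "y \<in> carrier E" for g y
    unfolding C_def by (rule L0_ext_Sup(2)[OF hm cS]) (use that in auto)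
  have Cle: "AE w in M. C g w \<le> u w" if "g \<in> ?D" "u \<in> borel_measurable M"
    "\<And>y. y \<in> carrier E \<Longrightarrow> AE w in M. h g y w \<le> u w" for g u
    unfolding C_def by (rule L0_ext_Sup(3)[OF hm cS]) (use that in auto)
  define k where "k g w = ereal (rep M (g x) w) - C g w" for g :: "'e \<Rightarrow> ('w \<Rightarrow> real) set" and w
  have km: "k g \<in> borel_measurable M" if "g \<in> ?D" for g
    unfolding k_def using gm[OF that x] Cm[OF that] by measurable
  let ?S = "Tc_biconjugate M E P f x"
  have bS: "?S = \<Squnion>\<^bsub>L0_ext M\<^esub>((\<lambda>g. ae_class M (k g)) ` ?D)"
    unfolding Tc_biconjugate_def k_def C_def using emb[OF _ x cc]
    by (intro arg_cong[of _ _ "\<lambda>A. \<Squnion>\<^bsub>L0_ext M\<^esub> A"] image_cong) auto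
  note Sc = L0_ext_Sup(1)[OF km bS]
  define s where "s = rep M ?S"
  have sm [measurable]: "s \<in> borel_measurable M" unfolding s_def by (rule rep_measurable[OF Sc])
  have sup: "AE w in M. k g w \<le> s w" if "g \<in> ?D" for g
    unfolding s_def by (rule L0_ext_Sup(2)[OF km bS that])
  note fm [measurable] = fr_measurable[OF x]
  have "AE w in M. s w \<le> fr x w"
    unfolding s_def
  proof (rule L0_ext_Sup(3)[OF km bS fm])
    fix g assume g: "g \<in> ?D"
    \<comment> \<open>The Fenchel-Young inequality, solved for the value of
      \<open>f\<close>.\<close>
    show "AE w in M. k g w \<le> fr x w"
      using Cup[OF g x] fr_gt_MInf[OF x]
    proof eventually_elim
      case (elim w)
      then show ?case by (cases "fr x w"; cases "C g w") (auto simp: h_def k_def)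
    qed
  qed
  moreover have "AE w in M. fr x w \<le> s w"
  proof (rule ccontr)
    assume neg: "\<not> (AE w in M. fr x w \<le> s w)"
    \<comment> \<open>Rational thresholds form a countable family: were all the sets where
      \<open>s < q < fr x\<close> null, so would be their union, which is the set where
      \<open>s < fr x\<close>.\<close>
    have "\<exists>q::rat. \<not> (AE w in M. \<not> (s w < ereal (of_rat q) \<and> ereal (of_rat q) < fr x w))"
    proof (rule ccontr)
      assume "\<not> ?thesis"
      then have "AE w in M. \<forall>q::rat. \<not> (s w < ereal (of_rat q) \<and> ereal (of_rat q) < fr x w)"
        by (simp add: AE_all_countable)
      then have "AE w in M. fr x w \<le> s w"
      proof eventually_elim
        case (elim w)
        show ?case
        proof (rule ccontr)
          assume "\<not> fr x w \<le> s w"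
          then obtain a b where ab: "s w < ereal a" "ereal a < ereal b" "ereal b < fr x w"
            by (metis ereal_dense2 not_le)
          then obtain q :: rat where "a < of_rat q" "of_rat q < b" using of_rat_dense[of a b] by auto
          then have "s w < ereal (of_rat q)" "ereal (of_rat q) < fr x w"
            using ab less_trans[of "s w" "ereal a"] less_trans[of _ "ereal b" "fr x w"] by auto
          then show False using elim by auto
        qed
      qed
      then show False using neg by simp
    qed
    then obtain r :: real where r: "\<not> (AE w in M. \<not> (s w < ereal r \<and> ereal r < fr x w))" by blast
    define B where "B = {w \<in> space M. s w < ereal r \<and> ereal r < fr x w}"
    have Bm: "B \<in> sets M" unfolding B_def by measurable
    have "prob B \<noteq> 0"
    proof
      assume "prob B = 0"
      then have "B \<in> null_sets M" using Bm by (simp add: null_sets_def emeasure_eq_measure)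
      then have "AE w in M. w \<notin> B" by (rule AE_not_in)
      then have "AE w in M. \<not> (s w < ereal r \<and> ereal r < fr x w)"
        using AE_space by eventually_elim (auto simp: B_def)
      then show False using r by simp
    qed
    then have Bpos: "prob B > 0" by (simp add: zero_less_measure_iff)
    have Bless: "AE w in M. w \<in> B \<longrightarrow> ereal r < fr x w" by (auto simp: B_def)
    obtain Q K B' where Q: "Q \<subseteq> P" "finite Q" and K: "K \<in> borel_measurable M" "\<forall>w. 0 \<le> K w"
      and B': "B' \<in> sets M" "B' \<subseteq> B" "prob B' > 0"
      and low: "\<forall>y\<in>carrier E. AE w in M. w \<in> B' \<longrightarrow>
        ereal (r - K w * psum Q (y \<oplus>\<^bsub>E\<^esub> sc (\<lambda>_. -1) x) w) \<le> fr y w"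
      by (rule lower_bound[OF x Bm Bpos Bless])
    obtain a where am': "\<forall>x\<in>carrier E. a x \<in> borel_measurable M"
      and aD: "(\<lambda>x. ae_class M (a x)) \<in> ?D"
      and al: "\<forall>y\<in>carrier E. AE w in M. w \<in> B' \<longrightarrow> ereal (a y w - a x w + r) \<le> fr y w"
      by (rule affine_minorant[OF Q x B'(1) borel_measurable_const K(1) K(2)[rule_format] low[rule_format]])
    note am = am'[rule_format]
    let ?g = "\<lambda>x. ae_class M (a x)"
    \<comment> \<open>On \<open>B'\<close> the affine minorant bounds the conjugate by
      \<open>a x - r\<close>; elsewhere \<infinity> is a bound that claims nothing.\<close>
    define u where "u w = (if w \<in> B' then ereal (a x w - r) else \<infinity>)" for w
    have um: "u \<in> borel_measurable M" unfolding u_def using B'(1) am[OF x] by measurable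
    have "AE w in M. C ?g w \<le> u w"
    proof (rule Cle[OF aD um])
      fix y assume y: "y \<in> carrier E"
      show "AE w in M. h ?g y w \<le> u w"
        using al[rule_format, OF y] rep_ae_class[OF am[OF y]]
      proof eventually_elim
        case (elim w)
        then show ?case by (cases "fr y w") (auto simp: h_def u_def)
      qed
    qed
    then have "AE w in M. w \<notin> B'"
      using rep_ae_class[OF am[OF x]] sup[OF aD]
    proof eventually_elim
      case (elim w)
      show ?case
      proof
        assume w: "w \<in> B'"
        then have "s w < ereal r" using B'(2) by (auto simp: B_def)
        moreover have "ereal r \<le> k ?g w" using elim(1,2) w by (cases "C ?g w") (auto simp: k_def u_def)
        ultimately show False using elim(3) by auto
      qed
    qed
    then have "B' \<in> null_sets M" using B'(1) by (simp add: AE_iff_null_sets)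
    then show False using B'(3) by (simp add: null_sets_def emeasure_eq_measure)
  qed
  ultimately have "AE w in M. s w = fr x w" by eventually_elim auto
  then have "ae_class M s = ae_class M (fr x)" by (simp add: ae_class_eq_iff)
  then show ?thesis using ae_class_rep[OF Sc] ae_class_fr[OF x] by (simp add: s_def)
qed

end

theorem theorem3p13:
  fixes M :: "'w measure"
    and E :: "(('w \<Rightarrow> real) set, 'e, 'm) module_scheme"
    and P :: "('e \<Rightarrow> ('w \<Rightarrow> real) set) set"
    and f :: "'e \<Rightarrow> ('w \<Rightarrow> ereal) set"
  assumes "random_locally_convex_module M E P"
    and "countable_concatenation M E"
    and "f \<in> carrier E \<rightarrow> carrier (L0_ext M)"
    and "L0_proper M E f"
    and "Tc_lsc M E P f"
    and "L0_convex M E f"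
  shows "\<forall>x\<in>carrier E. Tc_biconjugate M E P f x = f x"
proof -
  interpret proper_lsc_convex M E P f
    using assms by (simp add: proper_lsc_convex_def proper_lsc_convex_axioms_def)
  show ?thesis using Tc_biconjugate_eq by blast
qed

end
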